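(* Let $\kappa=[2\ell-1]$ for some $\ell\in\mathbb Z$, let $t=F+\check E+\kappa K^{-1}$, and define for $a\ge0$ $$\dot t^{(2a)}=\frac{1}{[2a]!}\prod_{j=-a+1}^{a}\bigl(t-[2j-1]\bigr),\qquad \dot t^{(2a+1)}=\frac{t}{[2a+1]!}\prod_{j=-a+1}^{a}\bigl(t-[2j-1]\bigr).$$ (1) Let $n\in\mathbb N$. For every integer $\lambda$ sufficiently large compared to $n$, the element $\dot t^{(n)}v^+_{2\lambda}$ is an $\imath$-canonical basis element of $L(2\lambda)$. (2) The set $\{\dot t^{(n)}\mid n\in\mathbb N\}$ is the $\imath$-canonical basis of $\mathbf U^\imath$ for even weights, and it is an $\mathcal A$-basis of ${}_{\mathcal A}\mathbf U^\imath_{\rm ev}$.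
   Context: $q$ is an indeterminate, $\mathcal A=\mathbb Z[q,q^{-1}]$, $[n]=\frac{q^n-q^{-n}}{q-q^{-1}}$, $[n]!=[1]\cdots[n]$, $[0]!=1$. $\mathbf U$ is the $\mathbb Q(q)$-algebra generated by $E,F,K^{\pm1}$ with relations $KK^{-1}=K^{-1}K=1$, $EF-FE=\frac{K-K^{-1}}{q-q^{-1}}$, $KE=q^2EK$, $KF=q^{-2}FK$; $\check E=q^{-1}EK^{-1}$, $F^{(n)}=F^n/[n]!$. $\mathbf U^\imath$ is the $\mathbb Q(q)$-subalgebra of $\mathbf U$ generated by $t$, and $\psi_\imath$ is the ring involution of $\mathbf U^\imath$ fixing $t$ and sending $q\mapsto q^{-1}$. For $\mu\in\mathbb N$, $L(\mu)$ is the simple $\mathbf U$-module of highest weight $\mu$ with highest weight vector $v^+_\mu$; it has basis $\{F^{(a)}v^+_\mu\}_{0\le a\le\mu}$ whose $\mathcal A$-span is $L(\mu)_{\mathcal A}$. The $\imath$-bar involution $\psi_\imath$ on $L(\mu)$ is the $q\mapsto q^{-1}$ semilinear map with $\psi_\imath(xv^+_\mu)=\psi_\imath(x)v^+_\mu$ for $x\in\mathbf U^\imath$. For $0\le a\le\mu$ the $\imath$-canonical basis element $b^\mu_a\in L(\mu)$ is the unique element with $\psi_\imath(b^\mu_a)=b^\mu_a$ and $b^\mu_a\in F^{(a)}v^+_\mu+\sum_{0\le r<a}q^{-1}\mathbb Z[q^{-1}]F^{(r)}v^+_\mu$ (these exist by Bao–Wang). ${}_{\mathcal A}\mathbf U^\imath_{\rm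 ev}=\{x\in\mathbf U^\imath: xv\in L(\mu)_{\mathcal A}\ \forall v\in L(\mu)_{\mathcal A},\ \forall \mu\in 2\mathbb N\}$. The $\imath$-canonical basis of $\mathbf U^\imath$ for even weights (Bao–Wang) is the family $\{B_n\}_{n\in\mathbb N}\subset{}_{\mathcal A}\mathbf U^\imath_{\rm ev}$ characterized by: for each $n$, $B_nv^+_{2\lambda}=b^{2\lambda}_n$ for all $\lambda\gg0$. *)

theory Defs
  imports "HOL-Computational_Algebra.Polynomial" "HOL-Computational_Algebra.Fraction_Field"
begin

type_synonym qf = "rat poly fract"

definition qq :: qf where "qq = Fract [:0, 1:] 1"

(* q^d * p(q^{-1}) for a polynomial p of degree at most d *)
definition poly_inv :: "nat \<Rightarrow> rat poly \<Rightarrow> rat poly" where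
  "poly_inv d p = (\<Sum>i\<le>d. monom (coeff p i) (d - i))"

(* the field involution q \<mapsto> q^{-1} of Q(q) *)
definition qbar :: "qf \<Rightarrow> qf" where
  "qbar x = (let (a, b) = (SOME (a, b). b \<noteq> 0 \<and> x = Fract a b);
                 D = max (degree a) (degree b)
             in Fract (poly_inv D a) (poly_inv D b))"

definition qint :: "int \<Rightarrow> qf" where
  "qint n = (qq powi n - qq powi (- n)) / (qq - inverse qq)"

definition qfact :: "nat \<Rightarrow> qf" where
  "qfact n = (\<Prod>i\<in>{1..n}. qint (int i))"

(* A = Z[q,q^{-1}] inside Q(q) *)
definition Aset :: "qf set" where
  "Aset = {x. \<exists>(p::int poly) k. x = Fract (map_poly of_int p) (monom 1 k)}"

(* q^{-1} Z[q^{-1}] inside Q(q) *)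
definition qinvZ :: "qf set" where
  "qinvZ = {x. \<exists>(p::int poly) k. degree p < k \<and> x = Fract (map_poly of_int p) (monom 1 k)}"

text \<open>A vector of L(mu) is given by its coordinates w a with respect to the basis
  F^(a) v^+_mu (0 \<le> a \<le> mu); coordinates with a > mu are 0.\<close>

type_synonym vec = "nat \<Rightarrow> qf"

definition inL :: "nat \<Rightarrow> vec \<Rightarrow> bool" where
  "inL mu w \<longleftrightarrow> (\<forall>a>mu. w a = 0)"

definition hw :: "nat \<Rightarrow> vec" where
  "hw mu = (\<lambda>a. if a = 0 then 1 else 0)"

(* F F^(a-1) v = [a] F^(a) v *)
definition Fop :: "nat \<Rightarrow> vec \<Rightarrow> vec" where
  "Fop mu w = (\<lambda>a. if 1 \<le> a \<and> a \<le> mu then qint (int a) * w (a - 1) else 0)"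

(* E F^(a+1) v = [mu-a] F^(a) v *)
definition Eop :: "nat \<Rightarrow> vec \<Rightarrow> vec" where
  "Eop mu w = (\<lambda>a. if a < mu then qint (int mu - int a) * w (a + 1) else 0)"

definition Kop :: "nat \<Rightarrow> vec \<Rightarrow> vec" where
  "Kop mu w = (\<lambda>a. if a \<le> mu then qq powi (int mu - 2 * int a) * w a else 0)"

definition Kinvop :: "nat \<Rightarrow> vec \<Rightarrow> vec" where
  "Kinvop mu w = (\<lambda>a. if a \<le> mu then qq powi (2 * int a - int mu) * w a else 0)"

definition Echeckop :: "nat \<Rightarrow> vec \<Rightarrow> vec" where
  "Echeckop mu w = (\<lambda>a. inverse qq * Eop mu (Kinvop mu w) a)"

definition top :: "qf \<Rightarrow> nat \<Rightarrow> vec \<Rightarrow> vec" where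
  "top kappa mu w = (\<lambda>a. Fop mu w a + Echeckop mu w a + kappa * Kinvop mu w a)"

text \<open>Elements of U^i (the subalgebra generated by t) are represented as polynomials
  p in t; p acts on L(mu) as p(t).\<close>

definition act :: "qf \<Rightarrow> nat \<Rightarrow> qf poly \<Rightarrow> vec \<Rightarrow> vec" where
  "act kappa mu p w = (\<lambda>a. \<Sum>i\<le>degree p. coeff p i * ((top kappa mu ^^ i) w) a)"

definition psiU :: "qf poly \<Rightarrow> qf poly" where
  "psiU p = map_poly qbar p"

(* psi_i on L(mu): psi_i(x v^+) = psi_i(x) v^+ *)
definition psiL :: "qf \<Rightarrow> nat \<Rightarrow> vec \<Rightarrow> vec" where
  "psiL kappa mu w = (SOME y. \<exists>p. w = act kappa mu p (hw mu) \<and> y = act kappa mu (psiU p) (hw mu))"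

definition is_icb :: "qf \<Rightarrow> nat \<Rightarrow> nat \<Rightarrow> vec \<Rightarrow> bool" where
  "is_icb kappa mu a w \<longleftrightarrow> a \<le> mu \<and> inL mu w \<and> psiL kappa mu w = w \<and>
     w a = 1 \<and> (\<forall>r<a. w r \<in> qinvZ) \<and> (\<forall>r>a. w r = 0)"

definition LA :: "nat \<Rightarrow> vec set" where
  "LA mu = {w. inL mu w \<and> (\<forall>a. w a \<in> Aset)}"

definition AUev :: "qf \<Rightarrow> qf poly set" where
  "AUev kappa = {x. \<forall>mu. even mu \<longrightarrow> (\<forall>w\<in>LA mu. act kappa mu x w \<in> LA mu)}"

definition is_icb_family :: "qf \<Rightarrow> (nat \<Rightarrow> qf poly) \<Rightarrow> bool" where
  "is_icb_family kappa B \<longleftrightarrow> (\<forall>n. B n \<in> AUev kappa \<and>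
     (\<exists>N. \<forall>lam\<ge>N. is_icb kappa (2 * lam) n (act kappa (2 * lam) (B n) (hw (2 * lam)))))"

definition is_A_basis :: "(nat \<Rightarrow> qf poly) \<Rightarrow> qf poly set \<Rightarrow> bool" where
  "is_A_basis B S \<longleftrightarrow> (\<forall>n. B n \<in> S) \<and>
     (\<forall>x\<in>S. \<exists>!c :: nat \<Rightarrow> qf. (\<forall>n. c n \<in> Aset) \<and> finite {n. c n \<noteq> 0} \<and>
        x = (\<Sum>n\<in>{n. c n \<noteq> 0}. smult (c n) (B n)))"

definition tdot :: "nat \<Rightarrow> qf poly" where
  "tdot n = (let a = n div 2;
                 P = (\<Prod>j\<in>{- int a + 1 .. int a}. [:- qint (2 * j - 1), 1:])
             in if even n then smult (inverse (qfact n)) P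
                else smult (inverse (qfact n)) ([:0, 1:] * P))"

end

theory Submission
  imports Defs
begin

text \<open>
  Write \<open>\<kappa> = [m]\<close> with \<open>m\<close> odd, and for odd \<open>s\<close> consider the shifted divided powers
  \<open>t_s^(n) = (t - [s]) (t - [s + 2]) \<cdots> (t - [s + 2 n - 2]) / [n]!\<close>.
  Their \<open>\<A>\<close>-span does not depend on \<open>s\<close>, is closed under multiplication, and contains all
  \<open>tdot n\<close>. For \<open>s = m - \<mu>\<close> the vectors \<open>t_s^(n) v\<close> have an explicit product formula in terms of
  Gaussian binomial coefficients, unitriangular over \<open>\<A>\<close> and vanishing for \<open>n = \<mu> + 1\<close>.
  Hence the span preserves the integral form \<open>L(\<mu>)_\<A>\<close> for even \<open>\<mu>\<close>, and the annihilator of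
  \<open>v\<close> is bar invariant. Conversely the top coordinate of \<open>x v\<close> reads off the leading coefficient of
  \<open>x\<close>, so that integral elements are \<open>\<A>\<close>-combinations of the \<open>tdot n\<close>. Finally, as
  \<open>\<mu> \<rightarrow> \<infinity>\<close>, the coordinates of \<open>tdot n v\<close> converge in the \<open>q\<^sup>-\<^sup>1\<close>-adic topology; the limits below
  the top one are explicit of negative degree, which puts the coordinates themselves into
  \<open>q\<^sup>-\<^sup>1 \<int>[q\<^sup>-\<^sup>1]\<close> for large \<open>\<mu>\<close>.
\<close>

section \<open>Quantum integers\<close>

lemma qq_nonzero [simp]: "qq \<noteq> 0"
  by (simp add: qq_def Zero_fract_def eq_fract)

lemma qq_power: "qq ^ n = Fract (monom 1 n) 1"
  by (induction n) (simp_all add: qq_def One_fract_def monom_Suc one_pCons monom_0)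

lemma qq_power_eq_1_iff: "qq ^ n = 1 \<longleftrightarrow> n = 0"
proof -
  have "monom (1::rat) n = 1 \<Longrightarrow> n = 0"
    by (metis degree_1 degree_monom_eq zero_neq_one)
  thus ?thesis
    by (auto simp: qq_power One_fract_def eq_fract)
qed

lemma qq_powi_add: "qq powi (m + n) = qq powi m * qq powi n"
  by (simp add: power_int_add)

lemma qq_powi_diff: "qq powi (m - n) = qq powi m / qq powi n"
  by (simp add: power_int_diff)

lemma qq_powi_eq_1_iff: "qq powi n = 1 \<longleftrightarrow> n = 0"
proof (cases "n \<ge> 0")
  case True
  then show ?thesis
    using qq_power_eq_1_iff[of "nat n"] by (auto simp: power_int_def)
next
  case False
  then show ?thesis
    using qq_power_eq_1_iff[of "nat (- n)"] by (auto simp: power_int_def power_inverse)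
qed

lemma qq_powi_diff_eq_0_iff: "qq powi n - qq powi (- n) = 0 \<longleftrightarrow> n = 0"
proof
  assume "qq powi n - qq powi (- n) = 0"
  hence "qq powi n = inverse (qq powi n)"
    by (simp add: power_int_minus)
  hence "qq powi n * qq powi n = 1"
    by (metis power_int_not_zero qq_nonzero right_inverse)
  hence "qq powi (n + n) = 1"
    by (simp only: qq_powi_add)
  thus "n = 0"
    by (simp add: qq_powi_eq_1_iff)
qed simp

lemma qq_neq_inverse [simp]: "qq \<noteq> inverse qq" "inverse qq \<noteq> qq"
  using qq_powi_diff_eq_0_iff[of 1] by (auto simp: power_int_minus)

text \<open>A name for the scalar 1/(q - q^-1) keeps this denominator opaque to
  \<open>field_simps\<close>, so that identities between quantum integers reduce to identities
  between powers of q.\<close>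

definition qdel :: qf where
  "qdel = inverse (qq - inverse qq)"

lemma qint_conv: "qint n = qdel * (qq powi n - inverse (qq powi n))"
  by (simp add: qint_def qdel_def power_int_minus field_simps)

lemma qint_0 [simp]: "qint 0 = 0"
  by (simp add: qint_def)

lemma qint_1 [simp]: "qint 1 = 1"
  by (simp add: qint_def power_int_minus)

lemma qint_eq_0_iff [simp]: "qint n = 0 \<longleftrightarrow> n = 0"
  using qq_powi_diff_eq_0_iff[of n] by (simp add: qint_def)

lemma qint_Suc_nonzero [simp]: "qint (1 + int n) \<noteq> 0" "qint (int n + 1) \<noteq> 0"
  by simp_all

lemma qint_minus [simp]: "qint (- n) = - qint n"
  by (simp add: qint_def diff_divide_distrib)

lemma qint_add: "qint (m + n) = qq powi n * qint m + qq powi (- m) * qint n"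
  unfolding qint_conv qq_powi_add power_int_minus by (simp add: field_simps)

lemma qfact_0 [simp]: "qfact 0 = 1"
  by (simp add: qfact_def)

lemma qfact_Suc: "qfact (Suc n) = qint (int (Suc n)) * qfact n"
  by (simp add: qfact_def)

lemma qfact_nonzero [simp]: "qfact n \<noteq> 0"
  by (simp add: qfact_def)

section \<open>Integral and negative-degree rational functions\<close>

lemma of_int_poly_add:
  "map_poly (of_int :: int \<Rightarrow> rat) (p + r) = map_poly of_int p + map_poly of_int r"
  by (rule poly_eqI) (simp add: coeff_map_poly)

lemma of_int_poly_mult:
  "map_poly (of_int :: int \<Rightarrow> rat) (p * r) = map_poly of_int p * map_poly of_int r"
  by (rule poly_eqI) (simp add: coeff_map_poly coeff_mult)

lemma of_int_poly_monom:
  "map_poly (of_int :: int \<Rightarrow> rat) (monom c k) = monom (of_int c) k"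
  by (rule poly_eqI) (simp add: coeff_map_poly)

lemma degree_of_int_poly: "degree (map_poly (of_int :: int \<Rightarrow> rat) p) = degree p"
  by (rule degree_map_poly) auto

lemma monom_1_nonzero [simp]: "monom (1::rat) k \<noteq> 0"
  by (simp add: monom_eq_0_iff)

lemma Aset_0 [simp]: "0 \<in> Aset"
  unfolding Aset_def by (auto simp: Zero_fract_def eq_fract intro!: exI[of _ 0])

lemma Aset_add:
  assumes "x \<in> Aset" "y \<in> Aset"
  shows "x + y \<in> Aset"
proof -
  obtain p j where x: "x = Fract (map_poly of_int (p::int poly)) (monom 1 j)"
    using assms(1) by (auto simp: Aset_def)
  obtain r k where y: "y = Fract (map_poly of_int (r::int poly)) (monom 1 k)"
    using assms(2) by (auto simp: Aset_def)
  have "x + y = Fract (map_poly of_int (p * monom 1 k + r * monom 1 j)) (monom 1 (j + k))"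
    by (simp add: x y of_int_poly_add of_int_poly_mult of_int_poly_monom mult_monom)
  thus ?thesis
    unfolding Aset_def by blast
qed

lemma Aset_mult:
  assumes "x \<in> Aset" "y \<in> Aset"
  shows "x * y \<in> Aset"
proof -
  obtain p j where x: "x = Fract (map_poly of_int (p::int poly)) (monom 1 j)"
    using assms(1) by (auto simp: Aset_def)
  obtain r k where y: "y = Fract (map_poly of_int (r::int poly)) (monom 1 k)"
    using assms(2) by (auto simp: Aset_def)
  have "x * y = Fract (map_poly of_int (p * r)) (monom 1 (j + k))"
    by (simp add: x y of_int_poly_mult mult_monom)
  thus ?thesis
    unfolding Aset_def by blast
qed

lemma Aset_qq_powi [simp]: "qq powi n \<in> Aset"
proof (cases "n \<ge> 0")
  case True
  hence "qq powi n = Fract (map_poly of_int (monom (1::int) (nat n))) (monom 1 0)"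
    by (simp add: power_int_def qq_power of_int_poly_monom eq_fract)
  then show ?thesis
    unfolding Aset_def by blast
next
  case False
  hence "qq powi n = Fract (map_poly of_int (monom (1::int) 0)) (monom 1 (nat (- n)))"
    by (simp add: power_int_def qq_power of_int_poly_monom eq_fract add: power_inverse)
  then show ?thesis
    unfolding Aset_def by blast
qed

lemma Aset_1 [simp]: "1 \<in> Aset"
  using Aset_qq_powi[of 0] by simp

lemma Aset_minus_1: "- 1 \<in> Aset"
proof -
  have "- 1 = Fract (map_poly of_int (monom (-1::int) 0)) (monom (1::rat) 0)"
    by (simp add: of_int_poly_monom One_fract_def eq_fract monom_0 one_pCons map_poly_pCons)
  thus ?thesis
    unfolding Aset_def by blast
qed

lemma Aset_minus: "x \<in> Aset \<Longrightarrow> - x \<in> Aset"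
  using Aset_mult[OF Aset_minus_1, of x] by simp

lemma Aset_diff: "x \<in> Aset \<Longrightarrow> y \<in> Aset \<Longrightarrow> x - y \<in> Aset"
  using Aset_add[of x "- y"] by (simp add: Aset_minus)

lemma Aset_sum: "(\<And>i. i \<in> I \<Longrightarrow> f i \<in> Aset) \<Longrightarrow> sum f I \<in> Aset"
  by (induction I rule: infinite_finite_induct) (auto intro: Aset_add)

lemma Aset_prod: "(\<And>i. i \<in> I \<Longrightarrow> f i \<in> Aset) \<Longrightarrow> prod f I \<in> Aset"
  by (induction I rule: infinite_finite_induct) (auto intro: Aset_mult)

section \<open>The degree filtration of Q(q), that is, the valuation at q = infinity\<close>

definition deg_le :: "int \<Rightarrow> qf set" where
  "deg_le k = {x. \<exists>a b. b \<noteq> 0 \<and> x = Fract a b \<and> int (degree a) \<le> k + int (degree b)} \<union> {0}"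

lemma deg_le_0 [simp]: "0 \<in> deg_le k"
  by (simp add: deg_le_def)

lemma deg_leI:
  "b \<noteq> 0 \<Longrightarrow> x = Fract a b \<Longrightarrow> int (degree a) \<le> k + int (degree b) \<Longrightarrow> x \<in> deg_le k"
  by (auto simp: deg_le_def)

lemma deg_leE:
  assumes "x \<in> deg_le k" "x \<noteq> 0"
  obtains a b where "a \<noteq> 0" "b \<noteq> 0" "x = Fract a b" "int (degree a) \<le> k + int (degree b)"
proof -
  obtain a b where *: "b \<noteq> 0" "x = Fract a b" "int (degree a) \<le> k + int (degree b)"
    using assms by (auto simp: deg_le_def)
  moreover have "a \<noteq> 0"
    using * assms(2) by (auto simp: fract_collapse)
  ultimately show thesis
    using that by blast
qed

lemma deg_le_mono:
  assumes "x \<in> deg_le k" "k \<le> k'"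
  shows "x \<in> deg_le k'"
proof (cases "x = 0")
  case False
  obtain a b where "b \<noteq> 0" "x = Fract a b" "int (degree a) \<le> k + int (degree b)"
    using deg_leE[OF assms(1) False] by metis
  thus ?thesis
    using assms(2) by (intro deg_leI[of b x a]) auto
qed simp

lemma deg_le_add:
  assumes "x \<in> deg_le k" "y \<in> deg_le k"
  shows "x + y \<in> deg_le k"
proof (cases "x = 0 \<or> y = 0")
  case True
  then show ?thesis
    using assms by auto
next
  case False
  obtain a b where x: "a \<noteq> 0" "b \<noteq> 0" "x = Fract a b" "int (degree a) \<le> k + int (degree b)"
    using deg_leE[OF assms(1)] False by metis
  obtain c d where y: "c \<noteq> 0" "d \<noteq> 0" "y = Fract c d" "int (degree c) \<le> k + int (degree d)"
    using deg_leE[OF assms(2)] False by metis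
  have "degree (a * d + c * b) \<le> max (degree (a * d)) (degree (c * b))"
    by (rule degree_add_le_max)
  thus ?thesis
    using x y by (intro deg_leI[of "b * d" _ "a * d + c * b"]) (auto simp: degree_mult_eq)
qed

lemma deg_le_mult:
  assumes "x \<in> deg_le j" "y \<in> deg_le k"
  shows "x * y \<in> deg_le (j + k)"
proof (cases "x = 0 \<or> y = 0")
  case False
  obtain a b where x: "a \<noteq> 0" "b \<noteq> 0" "x = Fract a b" "int (degree a) \<le> j + int (degree b)"
    using deg_leE[OF assms(1)] False by metis
  obtain c d where y: "c \<noteq> 0" "d \<noteq> 0" "y = Fract c d" "int (degree c) \<le> k + int (degree d)"
    using deg_leE[OF assms(2)] False by metis
  show ?thesis
    using x y by (intro deg_leI[of "b * d" _ "a * c"]) (auto simp: degree_mult_eq)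
qed auto

lemma deg_le_exists: "\<exists>k. x \<in> deg_le (int k)"
proof (cases x)
  case (Fract a b)
  thus ?thesis
    by (intro exI[of _ "degree a"] deg_leI[of b x a]) auto
qed

lemma deg_le_qq_powi: "qq powi n \<in> deg_le n"
proof (cases "n \<ge> 0")
  case True
  thus ?thesis
    by (intro deg_leI[of 1 _ "monom 1 (nat n)"])
       (auto simp: power_int_def qq_power degree_monom_eq)
next
  case False
  thus ?thesis
    by (intro deg_leI[of "monom 1 (nat (- n))" _ 1])
       (auto simp: power_int_def qq_power degree_monom_eq simp: power_inverse)
qed

text \<open>The inverse equals q^n / (q^(2n) - 1), of degree n - 2n.\<close>

lemma deg_le_inverse_qq_diff:
  assumes "n > 0"
  shows "inverse (qq powi n - qq powi (- n)) \<in> deg_le (- n)"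
proof -
  define k where "k = nat n"
  have n: "n = int k" "k > 0"
    using assms by (auto simp: k_def)
  have "degree (monom (1::rat) (2 * k) - 1) = 2 * k"
    using n degree_add_eq_left[of "- 1" "monom (1::rat) (2 * k)"] by (simp add: degree_monom_eq)
  moreover from this have "monom (1::rat) (2 * k) - 1 \<noteq> 0"
    using n by (metis degree_0 less_numeral_extra(3) nat_0_less_mult_iff zero_less_numeral)
  moreover have "inverse (qq powi n - qq powi (- n)) = Fract (monom 1 k) (monom 1 (2 * k) - 1)"
    by (simp add: n power_int_minus qq_power mult_monom mult_2 eq_fract One_fract_def)
  ultimately show ?thesis
    using n by (intro deg_leI[of "monom 1 (2 * k) - 1" _ "monom 1 k"]) (auto simp: degree_monom_eq)
qed

text \<open>Cross-multiplying two fractions for x shows that the degree of numerator minus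
  denominator does not depend on the fraction, so it can be read off from p / q^k. Integrality and
  negative degree of a coordinate can therefore be established separately.\<close>

lemma qinvZ_if_deg_le:
  assumes "x \<in> Aset" "x \<in> deg_le (- 1)"
  shows "x \<in> qinvZ"
proof (cases "x = 0")
  case True
  hence "x = Fract (map_poly of_int (0::int poly)) (monom 1 1)"
    by (simp add: fract_collapse)
  moreover have "degree (0 :: int poly) < 1"
    by simp
  ultimately show ?thesis
    unfolding qinvZ_def by blast
next
  case False
  obtain p k where x: "x = Fract (map_poly of_int (p::int poly)) (monom 1 k)"
    using assms(1) by (auto simp: Aset_def)
  obtain a b where *: "a \<noteq> 0" "b \<noteq> 0" "x = Fract a b" "int (degree a) \<le> - 1 + int (degree b)"
    using deg_leE[OF assms(2) False] by metis
  have nz: "map_poly (of_int :: int \<Rightarrow> rat) p \<noteq> 0"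
    using False x by (auto simp: fract_collapse)
  have "map_poly of_int p * b = a * monom 1 k"
    using x * by (simp add: eq_fract)
  hence "degree p + degree b = degree a + k"
    using * nz by (metis degree_monom_eq degree_mult_eq degree_of_int_poly monom_1_nonzero zero_neq_one)
  hence "degree p < k"
    using * by auto
  thus ?thesis
    using x unfolding qinvZ_def by blast
qed

section \<open>Gaussian binomial coefficients\<close>

lemma qint_in_Aset [simp]: "qint n \<in> Aset"
proof -
  have *: "qint (int k) \<in> Aset" for k
  proof (induction k)
    case (Suc k)
    have "qint (int (Suc k)) = qq * qint (int k) + qq powi (- int k)"
      using qint_add[of "int k" 1] by (simp add: add.commute)
    thus ?case
      using Suc Aset_qq_powi[of 1] by (auto intro!: Aset_add Aset_mult)
  qed simp
  show ?thesis
  proof (cases "n \<ge> 0")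
    case True
    thus ?thesis using *[of "nat n"] by simp
  next
    case False
    thus ?thesis using Aset_minus[OF *[of "nat (- n)"]] by simp
  qed
qed

definition qbinom :: "int \<Rightarrow> nat \<Rightarrow> qf" where
  "qbinom M c = (\<Prod>i<c. qint (M - int i)) / qfact c"

lemma qbinom_0 [simp]: "qbinom M 0 = 1"
  by (simp add: qbinom_def)

lemma qbinom_Suc: "qbinom M (Suc c) = qbinom M c * qint (M - int c) / qint (int (Suc c))"
  by (simp add: qbinom_def qfact_Suc)

text \<open>The absorption identity: both sides are the same product of quantum integers over
  [c]!.\<close>

lemma qbinom_rec: "qint (int (Suc c)) * qbinom (M + 1) (Suc c) = qint (M + 1) * qbinom M c"
  unfolding qbinom_def prod.lessThan_Suc_shift qfact_Suc by (simp add: o_def)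

lemma qbinom_pascal:
  "qbinom (M + 1) (Suc c) = qq powi int (Suc c) * qbinom M (Suc c) + qq powi (int c - M) * qbinom M c"
proof -
  have "qint (M + 1) = qq powi int (Suc c) * qint (M - int c) + qq powi (int c - M) * qint (int (Suc c))"
    using qint_add[of "M - int c" "int (Suc c)"] by (simp add: algebra_simps)
  thus ?thesis
    using qbinom_rec[of c M] by (simp add: qbinom_Suc field_simps)
qed

lemma qbinom_eq_0: "0 \<le> M \<Longrightarrow> M < int c \<Longrightarrow> qbinom M c = 0"
  unfolding qbinom_def by (auto intro!: bexI[of _ "nat M"])

text \<open>The q-Pascal rule has coefficients in A, so integrality follows by induction although
  the definition divides by \<open>qfact c\<close>.\<close>

lemma qbinom_in_Aset: "qbinom (int M) c \<in> Aset"
proof (induction M arbitrary: c)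
  case 0
  thus ?case by (cases c) (simp_all add: qbinom_eq_0)
next
  case (Suc M)
  thus ?case
  proof (cases c)
    case (Suc c')
    thus ?thesis
      using qbinom_pascal[of "int M" c'] Suc.IH
      by (auto simp: add.commute intro!: Aset_add Aset_mult)
  qed simp
qed

lemma qfact_add: "qfact (n + k) = qbinom (int (n + k)) n * (qfact n * qfact k)"
proof (induction n arbitrary: k)
  case (Suc n)
  have "qfact (Suc n + k) = qbinom (int (Suc n + k)) n * (qfact n * qfact (Suc k))"
    using Suc[of "Suc k"] by simp
  also have "\<dots> = qbinom (int (Suc n + k)) (Suc n) * (qfact (Suc n) * qfact k)"
  proof -
    have "int (Suc n + k) - int n = int (Suc k)" by simp
    thus ?thesis
      unfolding qbinom_Suc qfact_Suc by simp
  qed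
  finally show ?case .
qed simp

section \<open>The bar involution\<close>

definition const_fract :: "rat \<Rightarrow> qf" where
  "const_fract c = Fract [:c:] 1"

lemma const_fract_0 [simp]: "const_fract 0 = 0"
  by (simp add: const_fract_def fract_collapse)

lemma const_fract_add: "const_fract (c + d) = const_fract c + const_fract d"
  by (simp add: const_fract_def)

lemma const_fract_mult: "const_fract (c * d) = const_fract c * const_fract d"
  by (simp add: const_fract_def mult.commute)

text \<open>Evaluation at \<open>q\<^sup>-\<^sup>1\<close>, which shows that \<open>qbar\<close> does not depend on the chosen fraction.\<close>

definition eval_inv :: "rat poly \<Rightarrow> qf" where
  "eval_inv p = poly (map_poly const_fract p) (inverse qq)"

lemma eval_inv_0 [simp]: "eval_inv 0 = 0"
  by (simp add: eval_inv_def)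

lemma eval_inv_pCons: "eval_inv (pCons c p) = const_fract c + inverse qq * eval_inv p"
  by (simp add: eval_inv_def map_poly_pCons)

lemma eval_inv_1 [simp]: "eval_inv 1 = 1"
  by (simp add: one_pCons eval_inv_pCons const_fract_def One_fract_def)

lemma eval_inv_add: "eval_inv (p + r) = eval_inv p + eval_inv r"
proof -
  have "map_poly const_fract (p + r) = map_poly const_fract p + map_poly const_fract r"
    by (rule poly_eqI) (simp add: coeff_map_poly const_fract_add)
  thus ?thesis
    by (simp add: eval_inv_def)
qed

lemma eval_inv_smult: "eval_inv (smult c p) = const_fract c * eval_inv p"
  by (induction p) (simp_all add: eval_inv_pCons const_fract_mult algebra_simps)

lemma eval_inv_mult: "eval_inv (p * r) = eval_inv p * eval_inv r"
  by (induction p) (simp_all add: eval_inv_pCons eval_inv_add eval_inv_smult algebra_simps)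

text \<open>In \<open>qbar\<close> the numerator and the denominator are reversed with the same D,
  so the factors q^D produced here cancel.\<close>

lemma Fract_poly_inv:
  assumes "degree p \<le> D"
  shows "Fract (poly_inv D p) 1 = qq ^ D * eval_inv p"
proof -
  have Fract_sum: "Fract (sum f I) 1 = (\<Sum>i\<in>I. Fract (f i) 1)"
    if "finite I" for f :: "nat \<Rightarrow> rat poly" and I
  proof -
    have add: "Fract (u + v) 1 = Fract u 1 + Fract v 1" for u v :: "rat poly"
      by simp
    show ?thesis
      using that by (induction I) (simp_all add: fract_collapse add del: add_fract)
  qed
  have "degree (map_poly const_fract p) \<le> D"
    using assms by (intro degree_le) (auto simp: coeff_map_poly coeff_eq_0)
  hence "eval_inv p = (\<Sum>i\<le>D. coeff (map_poly const_fract p) i * inverse qq ^ i)"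
    unfolding eval_inv_def poly_altdef
    by (intro sum.mono_neutral_left) (auto simp: coeff_eq_0)
  also have "qq ^ D * \<dots> = (\<Sum>i\<le>D. const_fract (coeff p i) * qq ^ (D - i))"
    unfolding sum_distrib_left
  proof (rule sum.cong)
    fix i assume "i \<in> {..D}"
    hence "qq ^ D = qq ^ (D - i) * qq ^ i"
      by (simp flip: power_add)
    thus "qq ^ D * (coeff (map_poly const_fract p) i * inverse qq ^ i)
        = const_fract (coeff p i) * qq ^ (D - i)"
      by (simp add: coeff_map_poly power_inverse)
  qed simp
  also have "\<dots> = Fract (poly_inv D p) 1"
    unfolding poly_inv_def
    by (simp add: Fract_sum const_fract_def qq_power smult_monom)
  finally show ?thesis ..
qed

lemma poly_inv_nonzero:
  assumes "p \<noteq> 0" "degree p \<le> D"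
  shows "poly_inv D p \<noteq> 0"
proof -
  have "coeff (poly_inv D p) (D - degree p) = (\<Sum>i\<le>D. if i = degree p then coeff p i else 0)"
    unfolding poly_inv_def coeff_sum using assms(2) by (intro sum.cong) auto
  also have "\<dots> = lead_coeff p"
    using assms(2) by simp
  finally show ?thesis
    using assms(1) by (metis coeff_0 leading_coeff_0_iff)
qed

text \<open>Up to a power of q, p(q^-1) is the reversed polynomial of p, whose constant coefficient
  is the leading coefficient of p.\<close>

lemma eval_inv_nonzero:
  assumes "p \<noteq> 0"
  shows "eval_inv p \<noteq> 0"
proof
  assume "eval_inv p = 0"
  hence "Fract (poly_inv (degree p) p) 1 = 0"
    by (simp add: Fract_poly_inv)
  thus False
    using poly_inv_nonzero[OF assms order.refl] by (simp add: Zero_fract_def eq_fract)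
qed

text \<open>Two fractions for the same element satisfy a d = c b, and the multiplicative map
  \<open>eval_inv\<close> preserves this relation; hence the arbitrary choice inside
  \<open>qbar\<close> is harmless.\<close>

lemma qbar_Fract:
  assumes "b \<noteq> 0"
  shows "qbar (Fract a b) = eval_inv a / eval_inv b"
proof -
  define S where "S = (SOME (c, d). d \<noteq> 0 \<and> Fract a b = Fract c d)"
  obtain c d where S: "S = (c, d)"
    by (cases S)
  have "case S of (c, d) \<Rightarrow> d \<noteq> 0 \<and> Fract a b = Fract c d"
    unfolding S_def by (rule someI[of _ "(a, b)"]) (use assms in auto)
  hence d: "d \<noteq> 0" "Fract a b = Fract c d"
    by (auto simp: S)
  define D where "D = max (degree c) (degree d)"
  have D: "degree c \<le> D" "degree d \<le> D"
    by (auto simp: D_def)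
  have nz: "poly_inv D d \<noteq> 0"
    using d D by (simp add: poly_inv_nonzero)
  have "qbar (Fract a b) = Fract (poly_inv D c) (poly_inv D d)"
    unfolding qbar_def S_def[symmetric] by (simp add: S Let_def D_def)
  also have "\<dots> = Fract (poly_inv D c) 1 / Fract (poly_inv D d) 1"
    using nz by simp
  also have "\<dots> = eval_inv c / eval_inv d"
    using D by (simp add: Fract_poly_inv)
  also have "\<dots> = eval_inv a / eval_inv b"
  proof -
    have "a * d = c * b"
      using d assms by (simp add: eq_fract)
    hence "eval_inv a * eval_inv d = eval_inv c * eval_inv b"
      by (metis eval_inv_mult)
    thus ?thesis
      using assms d eval_inv_nonzero[of b] eval_inv_nonzero[of d] by (simp add: field_simps)
  qed
  finally show ?thesis .
qed

lemma qbar_add: "qbar (x + y) = qbar x + qbar y"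
proof (cases x)
  case x: (Fract a b)
  show ?thesis
  proof (cases y)
    case y: (Fract c d)
    show ?thesis
      using x y eval_inv_nonzero[of b] eval_inv_nonzero[of d]
      by (simp add: qbar_Fract eval_inv_add eval_inv_mult field_simps)
  qed
qed

lemma qbar_mult: "qbar (x * y) = qbar x * qbar y"
proof (cases x)
  case x: (Fract a b)
  show ?thesis
  proof (cases y)
    case y: (Fract c d)
    show ?thesis
      using x y by (simp add: qbar_Fract eval_inv_mult)
  qed
qed

lemma qbar_0 [simp]: "qbar 0 = 0"
  by (simp add: Zero_fract_def qbar_Fract)

lemma qbar_1 [simp]: "qbar 1 = 1"
  by (simp add: One_fract_def qbar_Fract)

lemma qbar_uminus: "qbar (- x) = - qbar x"
  using qbar_add[of x "- x"] by (simp add: eq_neg_iff_add_eq_0 add.commute)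

lemma qbar_diff: "qbar (x - y) = qbar x - qbar y"
  using qbar_add[of x "- y"] by (simp add: qbar_uminus)

lemma qbar_inverse: "qbar (inverse x) = inverse (qbar x)"
proof (cases "x = 0")
  case False
  hence "qbar x * qbar (inverse x) = 1"
    by (simp flip: qbar_mult)
  thus ?thesis
    by (metis inverse_unique)
qed simp

lemma qbar_qq: "qbar qq = inverse qq"
  by (simp add: qq_def qbar_Fract eval_inv_pCons flip: const_fract_def)
     (simp add: qq_def const_fract_def fract_collapse flip: One_fract_def one_pCons)

lemma qbar_power: "qbar (x ^ n) = qbar x ^ n"
  by (induction n) (simp_all add: qbar_mult)

lemma qbar_qq_powi: "qbar (qq powi n) = qq powi (- n)"
  by (cases "n \<ge> 0") (simp_all add: power_int_def qbar_power qbar_inverse qbar_qq)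

text \<open>Both \<open>qdel\<close> and q^n - q^-n change sign under q -> q^-1.\<close>

lemma qbar_qint [simp]: "qbar (qint n) = qint n"
proof -
  have "qbar qdel = - qdel"
    by (simp add: qdel_def qbar_inverse qbar_diff qbar_qq flip: inverse_minus_eq)
  thus ?thesis
    by (simp add: qint_conv qbar_mult qbar_diff qbar_inverse qbar_qq_powi power_int_minus algebra_simps)
qed

lemma qbar_qfact [simp]: "qbar (qfact n) = qfact n"
  by (induction n) (simp_all add: qfact_Suc qbar_mult del: of_nat_Suc)

section \<open>The bar involution on polynomials in t\<close>

lemma psiU_pCons: "psiU (pCons c p) = pCons (qbar c) (psiU p)"
  by (simp add: psiU_def map_poly_pCons)

lemma psiU_0 [simp]: "psiU 0 = 0"
  by (simp add: psiU_def)

lemma psiU_1 [simp]: "psiU 1 = 1"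
  by (simp add: one_pCons psiU_pCons)

lemma psiU_add: "psiU (p + r) = psiU p + psiU r"
  unfolding psiU_def by (rule poly_eqI) (simp add: coeff_map_poly qbar_add)

lemma psiU_smult: "psiU (smult c p) = smult (qbar c) (psiU p)"
  unfolding psiU_def by (rule poly_eqI) (simp add: coeff_map_poly qbar_mult)

lemma psiU_mult: "psiU (p * r) = psiU p * psiU r"
  by (induction p) (simp_all add: psiU_pCons psiU_add psiU_smult)

lemma psiU_prod: "psiU (prod f I) = (\<Prod>i\<in>I. psiU (f i))"
  by (induction I rule: infinite_finite_induct) (simp_all add: psiU_mult)

lemma psiU_linear_qint: "psiU [:- qint n, 1:] = [:- qint n, 1:]"
  by (simp add: psiU_pCons qbar_uminus)

section \<open>The action of \<open>t\<close> on \<open>L(\<mu>)\<close>\<close>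

text \<open>The tridiagonal matrix of t. The formula covers both ends of the basis: the quantum
  integer before \<open>w (a - 1)\<close> vanishes at a = 0, and the one before
  \<open>w (a + 1)\<close> vanishes at a = mu.\<close>

lemma top_eq:
  "Defs.top kappa mu w a = (if a \<le> mu then qint (int a) * w (a - 1)
     + qq powi (2 * int a + 1 - int mu) * qint (int mu - int a) * w (a + 1)
     + kappa * qq powi (2 * int a - int mu) * w a else 0)"
proof -
  have "inverse qq * qq powi (2 * (int a + 1) - int mu) = qq powi (2 * int a + 1 - int mu)"
    using qq_powi_add[of "2 * int a + 1 - int mu" 1] by (simp add: algebra_simps)
  thus ?thesis
    by (cases "a = 0"; cases "a = mu")
       (auto simp: Defs.top_def Fop_def Echeckop_def Eop_def Kinvop_def algebra_simps)
qed

lemma top_sum: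
  "Defs.top kappa mu (\<lambda>a. \<Sum>i\<in>I. c i * f i a) a = (\<Sum>i\<in>I. c i * Defs.top kappa mu (f i) a)"
  unfolding top_eq by (simp add: sum_distrib_left sum_distrib_right sum.distrib algebra_simps)

lemma act_eq_sum:
  assumes "degree p \<le> D"
  shows "act kappa mu p w a = (\<Sum>i\<le>D. coeff p i * ((Defs.top kappa mu ^^ i) w) a)"
  unfolding act_def using assms
  by (intro sum.mono_neutral_left) (auto simp: coeff_eq_0)

lemma act_0 [simp]: "act kappa mu 0 w = (\<lambda>a. 0)"
  by (simp add: act_def)

lemma act_pCons: "act kappa mu (pCons c p) w = (\<lambda>a. c * w a + Defs.top kappa mu (act kappa mu p w) a)"
proof
  fix a
  have "act kappa mu (pCons c p) w a
      = (\<Sum>i\<le>Suc (degree p). coeff (pCons c p) i * ((Defs.top kappa mu ^^ i) w) a)"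
    by (rule act_eq_sum) (rule degree_pCons_le)
  also have "\<dots> = c * w a + (\<Sum>i\<le>degree p. coeff p i * ((Defs.top kappa mu ^^ Suc i) w) a)"
    by (subst sum.atMost_Suc_shift) simp
  also have "(\<Sum>i\<le>degree p. coeff p i * ((Defs.top kappa mu ^^ Suc i) w) a)
      = Defs.top kappa mu (act kappa mu p w) a"
    unfolding act_def top_sum by simp
  finally show "act kappa mu (pCons c p) w a = c * w a + Defs.top kappa mu (act kappa mu p w) a" .
qed

lemma act_1 [simp]: "act kappa mu 1 w = w"
  by (rule ext) (simp add: one_pCons act_pCons top_eq)

lemma act_add: "act kappa mu (p + r) w a = act kappa mu p w a + act kappa mu r w a"
proof -
  define D where "D = max (degree p) (degree r)"
  have "degree (p + r) \<le> D" "degree p \<le> D" "degree r \<le> D"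
    by (auto simp: D_def degree_add_le)
  thus ?thesis
    by (simp add: act_eq_sum[of _ D] sum.distrib algebra_simps)
qed

lemma act_smult: "act kappa mu (smult c p) w a = c * act kappa mu p w a"
  by (simp add: act_eq_sum[of _ "degree p"] sum_distrib_left mult.assoc)

lemma act_diff: "act kappa mu (p - r) w a = act kappa mu p w a - act kappa mu r w a"
  using act_add[of kappa mu p "smult (- 1) r" w a] act_smult[of kappa mu "- 1" r w a] by simp

lemma act_mult: "act kappa mu (p * r) w = act kappa mu p (act kappa mu r w)"
proof (induction p)
  case (pCons c p)
  show ?case
    by (rule ext) (simp add: act_add act_smult act_pCons pCons)
qed simp

lemma act_sum: "act kappa mu p (\<lambda>a. \<Sum>i\<in>I. c i * f i a) a = (\<Sum>i\<in>I. c i * act kappa mu p (f i) a)"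
proof (induction p arbitrary: a)
  case (pCons d p)
  have "act kappa mu p (\<lambda>a. \<Sum>i\<in>I. c i * f i a) = (\<lambda>a. \<Sum>i\<in>I. c i * act kappa mu p (f i) a)"
    by (rule ext) (rule pCons)
  thus ?case
    by (simp add: act_pCons top_sum sum_distrib_left sum.distrib algebra_simps)
qed simp

lemma act_inL: "inL mu w \<Longrightarrow> inL mu (act kappa mu p w)"
  by (cases p) (simp add: act_pCons inL_def top_eq)

lemma hw_inL [simp]: "inL mu (hw mu)"
  by (simp add: inL_def hw_def)

text \<open>Only F raises the index, so t^d v has highest term F^d v = [d]! F^(d) v. Thus the
  leading coefficient of p is visible in p v as long as d does not exceed mu.\<close>

lemma act_hw_top_coeff:
  assumes "degree p \<le> d"
  shows "a > d \<Longrightarrow> act kappa mu p (hw mu) a = 0"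
    and "d \<le> mu \<Longrightarrow> act kappa mu p (hw mu) d = coeff p d * qfact d"
proof -
  have "(\<forall>a>d. act kappa mu p (hw mu) a = 0) \<and>
        (d \<le> mu \<longrightarrow> act kappa mu p (hw mu) d = coeff p d * qfact d)"
    using assms
  proof (induction d arbitrary: p)
    case 0
    then obtain c where "p = [:c:]"
      by (metis degree_0_id le_zero_eq)
    then show ?case
      by (auto simp: act_pCons top_eq hw_def)
  next
    case (Suc d)
    obtain c r where p: "p = pCons c r"
      by (cases p)
    have "degree r \<le> d"
      using Suc.prems by (auto simp: p split: if_splits)
    with Suc.IH[of r] show ?case
      by (auto simp: p act_pCons top_eq hw_def qfact_Suc)
  qed
  thus "a > d \<Longrightarrow> act kappa mu p (hw mu) a = 0"
    and "d \<le> mu \<Longrightarrow> act kappa mu p (hw mu) d = coeff p d * qfact d"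
    by auto
qed

section \<open>Shifted divided powers\<close>

definition tshift :: "int \<Rightarrow> nat \<Rightarrow> qf poly" where
  "tshift s n = smult (inverse (qfact n)) (\<Prod>i<n. [:- qint (s + 2 * int i), 1:])"

lemma tshift_0 [simp]: "tshift s 0 = 1"
  by (simp add: tshift_def)

lemma tshift_Suc:
  "smult (qint (int (Suc n))) (tshift s (Suc n)) = [:- qint (s + 2 * int n), 1:] * tshift s n"
proof -
  have "qint (int (Suc n)) * inverse (qfact (Suc n)) = inverse (qfact n)"
    by (simp add: qfact_Suc)
  thus ?thesis
    unfolding tshift_def prod.lessThan_Suc smult_smult
    by (simp only: mult_smult_right mult.commute)
qed

text \<open>The second factor starts at the root where the first one stops, so the roots form one
  uninterrupted run and only the quantum factorials have to be compared.\<close>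

lemma tshift_mult: "tshift s n * tshift (s + 2 * int n) k = smult (qbinom (int (n + k)) n) (tshift s (n + k))"
proof -
  have "(\<Prod>i<n + k. [:- qint (s + 2 * int i), 1:])
      = (\<Prod>i<n. [:- qint (s + 2 * int i), 1:]) * (\<Prod>i<k. [:- qint (s + 2 * int n + 2 * int i), 1:])"
  proof (induction k)
    case (Suc k)
    have "s + 2 * int (n + k) = s + 2 * int n + 2 * int k"
      by simp
    with Suc show ?case
      unfolding add_Suc_right prod.lessThan_Suc by (simp only: mult.assoc)
  qed simp
  moreover have "inverse (qfact n) * inverse (qfact k) = qbinom (int (n + k)) n * inverse (qfact (n + k))"
    using qfact_add[of n k] qfact_nonzero[of "n + k"] by (simp add: field_simps)
  ultimately show ?thesis
    by (simp add: tshift_def mult.commute)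
qed

text \<open>Both products of n + 1 factors share the n factors collected in \<open>P\<close> and
  differ only in one end root. The difference [s+2n+2] - [s] is divisible by [n+1], which lowers
  [n+1]! to [n]! and leaves a coefficient in A.\<close>

lemma tshift_shift:
  "tshift s (Suc n) = tshift (s + 2) (Suc n) + smult (qq powi (s + int n + 1) + qq powi (- (s + int n + 1))) (tshift (s + 2) n)"
proof -
  define P where "P = (\<Prod>i<n. [:- qint (s + 2 + 2 * int i), 1:])"
  have 1: "(\<Prod>i<Suc n. [:- qint (s + 2 * int i), 1:]) = [:- qint s, 1:] * P"
    unfolding prod.lessThan_Suc_shift P_def by (simp add: o_def algebra_simps)
  have 2: "(\<Prod>i<Suc n. [:- qint (s + 2 + 2 * int i), 1:]) = [:- qint (s + 2 + 2 * int n), 1:] * P"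
    unfolding P_def by (simp add: algebra_simps)
  have 3: "qint (s + 2 + 2 * int n) - qint s
      = qint (int (Suc n)) * (qq powi (s + int n + 1) + qq powi (- (s + int n + 1)))"
  proof -
    define A B where "A = qq powi (s + int n + 1)" and "B = qq powi int (Suc n)"
    have nz: "A \<noteq> 0" "B \<noteq> 0"
      by (simp_all add: A_def B_def)
    have "s + 2 + 2 * int n = (s + int n + 1) + int (Suc n)"
      by simp
    hence "qq powi (s + 2 + 2 * int n) = A * B"
      unfolding A_def B_def by (metis qq_powi_add)
    hence 1: "qint (s + 2 + 2 * int n) = qdel * (A * B - inverse (A * B))"
      by (simp only: qint_conv)
    have "s = (s + int n + 1) - int (Suc n)"
      by simp
    hence "qq powi s = A / B"
      unfolding A_def B_def by (metis qq_powi_diff)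
    hence 2: "qint s = qdel * (A / B - inverse (A / B))"
      by (simp only: qint_conv)
    have "(A * B - inverse (A * B)) - (A / B - inverse (A / B)) = (B - inverse B) * (A + inverse A)"
      using nz by (simp add: field_simps)
    thus ?thesis
      unfolding 1 2 unfolding qint_conv power_int_minus A_def[symmetric] B_def[symmetric]
      by (simp only: mult.assoc right_diff_distrib[symmetric])
  qed
  have 4: "[:- qint s, 1:] * P = [:- qint (s + 2 + 2 * int n), 1:] * P
     + smult (qint (s + 2 + 2 * int n) - qint s) P"
    by (simp add: smult_diff_left)
  have 5: "inverse (qfact (Suc n)) * (qint (int (Suc n)) * x) = x * inverse (qfact n)" for x
    by (simp add: qfact_Suc)
  show ?thesis
    unfolding tshift_def P_def[symmetric] 1 2 4 3 smult_add_right smult_smult 5 ..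
qed

lemma psiU_tshift: "psiU (tshift s n) = tshift s n"
  by (simp add: tshift_def psiU_smult psiU_prod psiU_linear_qint qbar_inverse)

section \<open>The A-span of the shifted divided powers: independence of the shift, closure under
  products\<close>

inductive_set tspan :: "int \<Rightarrow> qf poly set" for s where
  tspan_0: "0 \<in> tspan s"
| tspan_step: "c \<in> Aset \<Longrightarrow> p \<in> tspan s \<Longrightarrow> p + smult c (tshift s n) \<in> tspan s"

lemma tspan_add: "p \<in> tspan s \<Longrightarrow> r \<in> tspan s \<Longrightarrow> p + r \<in> tspan s"
proof (induction p rule: tspan.induct)
  case (tspan_step c p n)
  hence "(p + r) + smult c (tshift s n) \<in> tspan s"
    by (intro tspan.tspan_step) auto
  thus ?case
    by (simp add: algebra_simps)
qed simp

lemma tspan_smult: "p \<in> tspan s \<Longrightarrow> c \<in> Aset \<Longrightarrow> smult c p \<in> tspan s"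
  by (induction p rule: tspan.induct)
     (auto simp: smult_add_right intro: tspan.intros Aset_mult)

lemma tspan_tshift: "tshift s n \<in> tspan s"
  using tspan_step[OF Aset_1 tspan_0, of s n] by simp

lemma tspan_diff: "p \<in> tspan s \<Longrightarrow> r \<in> tspan s \<Longrightarrow> p - r \<in> tspan s"
  using tspan_add[of p s "smult (- 1) r"] tspan_smult[of r s "- 1"] Aset_minus_1 by simp

lemma tspan_shift_subset: "tspan s \<subseteq> tspan s'" if "\<And>n. tshift s n \<in> tspan s'"
proof
  fix p assume "p \<in> tspan s"
  thus "p \<in> tspan s'"
    by induction (auto intro: tspan_0 tspan_add tspan_smult that)
qed

text \<open>The relation \<open>tshift_shift\<close> is unitriangular over A and can be solved in
  either direction, inductively for one inclusion and directly for the other.\<close>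

lemma tspan_shift: "tspan (s + 2) = tspan s"
proof (intro equalityI tspan_shift_subset)
  fix n
  show "tshift (s + 2) n \<in> tspan s"
  proof (induction n)
    case 0
    show ?case
      using tspan_tshift[of s 0] by simp
  next
    case (Suc n)
    have "tshift (s + 2) (Suc n) = tshift s (Suc n)
       - smult (qq powi (s + int n + 1) + qq powi (- (s + int n + 1))) (tshift (s + 2) n)"
      by (simp only: tshift_shift[of s n] add_diff_cancel_right')
    thus ?case
      by (simp only:) (intro tspan_diff tspan_tshift tspan_smult Suc Aset_add Aset_qq_powi)
  qed
next
  fix n
  show "tshift s n \<in> tspan (s + 2)"
  proof (cases n)
    case 0
    thus ?thesis
      using tspan_tshift[of "s + 2" 0] by simp
  next
    case (Suc k)
    thus ?thesis
      by (auto simp only: tshift_shift[of s k] intro!: tspan_add tspan_smult tspan_tshift Aset_add Aset_qq_powi)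
  qed
qed

lemma tspan_shift_nat: "tspan (s + 2 * int k) = tspan s"
proof (induction k)
  case (Suc k)
  thus ?case
    using tspan_shift[of "s + 2 * int k"] by (simp add: algebra_simps)
qed simp

lemma tspan_odd:
  assumes "odd s" "odd s'"
  shows "tspan s = tspan s'"
proof -
  have *: "tspan s = tspan s'" if "odd s" "odd s'" "s \<le> s'" for s s' :: int
  proof -
    have "even (s' - s)"
      using that by simp
    then obtain k where "s' - s = 2 * k"
      by (elim evenE)
    hence "s' = s + 2 * int (nat k)"
      using that by simp
    thus ?thesis
      by (simp only: tspan_shift_nat)
  qed
  show ?thesis
    using linear[of s s'] *[OF assms] *[OF assms(2,1)] by (metis (no_types))
qed

text \<open>To multiply by \<open>tshift s n\<close>, the other factor is re-expanded with starting
  point s + 2n, which does not change the span; then \<open>tshift_mult\<close> applies term by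
  term.\<close>

lemma tspan_mult: "p \<in> tspan s \<Longrightarrow> r \<in> tspan s \<Longrightarrow> p * r \<in> tspan s"
proof (induction p rule: tspan.induct)
  case (tspan_step c p n)
  have "r \<in> tspan (s + 2 * int n)"
    using tspan_step.prems by (simp add: tspan_shift_nat)
  hence "tshift s n * r \<in> tspan s"
  proof induction
    case (tspan_step d p k)
    have "tshift s n * tshift (s + 2 * int n) k \<in> tspan s"
      unfolding tshift_mult by (intro tspan_smult tspan_tshift qbinom_in_Aset)
    thus ?case
      using tspan_step by (simp add: distrib_left tspan_add tspan_smult)
  qed (simp add: tspan_0)
  thus ?case
    using tspan_step by (simp add: distrib_right tspan_add tspan_smult)
qed (simp add: tspan_0)

section \<open>Shifted divided powers on the highest weight vector\<close>

text \<open>The three-term (Plucker type) relation for quantum integers; apart from the factor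
  \<open>qdel * qdel\<close> it is an identity in q^a, q^b and q^u.\<close>

lemma qint_exchange: "qint (a + u) * qint b = qint a * qint (b + u) + qint u * qint (b - a)"
proof -
  define A B U where defs: "A = qq powi a" "B = qq powi b" "U = qq powi u"
  have nz: "A \<noteq> 0" "B \<noteq> 0" "U \<noteq> 0"
    by (simp_all add: defs)
  have "(A * U - inverse (A * U)) * (B - inverse B)
     = (A - inverse A) * (B * U - inverse (B * U)) + (U - inverse U) * (B / A - inverse (B / A))"
    using nz by (simp add: field_simps)
  hence "qdel * qdel * ((A * U - inverse (A * U)) * (B - inverse B))
     = qdel * qdel * ((A - inverse A) * (B * U - inverse (B * U)) + (U - inverse U) * (B / A - inverse (B / A)))"
    by (simp only:)
  thus ?thesis
    unfolding qint_conv qq_powi_add qq_powi_diff defs[symmetric]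
    by (simp only: distrib_left mult.assoc mult.left_commute)
qed

text \<open>The scalar identity behind the induction step of \<open>act_tshift_hw\<close>, with M =
  mu - r and k = n - r. The summands on the right come from the coordinates r - 1, r + 1 and r after
  a common factor has been removed.\<close>

lemma tshift_hw_identity:
  "qint (r + k + 1) * qq powi (- m - k) * qint (M - k)
   = qint r * qq powi (- m - k) * qint (M + 1)
     + qint (k + 1) * qq powi (r + 1 - M) * qint k * qq powi (m + k - 1)
     + qint (k + 1) * (qint m * qq powi (r - M) - qint (m - M + r + 2 * k))"
proof -
  define D where "D = r - M + k"
  have 1: "qint (r + k + 1) * qint (M - k) = qint r * qint (M + 1) + qint (k + 1) * qint (- D)"
    using qint_exchange[of r "k + 1" "M - k"] by (simp add: D_def algebra_simps)
  have 2: "qint (m + D + k) = qq powi (r + 1 - M) * qq powi (m + k - 1) * qint k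
     + qint m * qq powi (r - M) + qq powi (- m - k) * qint D"
  proof -
    have "qint (m + D + k) = qq powi (m + D) * qint k + qq powi (- k) * qint (m + D)"
      using qint_add[of k "m + D"] by (simp add: add.commute)
    also have "qint (m + D) = qq powi D * qint m + qq powi (- m) * qint D"
      by (rule qint_add)
    also have "qq powi (m + D) = qq powi (r + 1 - M) * qq powi (m + k - 1)"
      unfolding qq_powi_add[symmetric] by (simp add: D_def algebra_simps)
    also have "qq powi (- k) * (qq powi D * qint m + qq powi (- m) * qint D)
        = qint m * (qq powi D * qq powi (- k)) + (qq powi (- m) * qq powi (- k)) * qint D"
      by (simp add: algebra_simps)
    also have "qq powi D * qq powi (- k) = qq powi (r - M)"
      unfolding qq_powi_add[symmetric] by (simp add: D_def)
    also have "qq powi (- m) * qq powi (- k) = qq powi (- m - k)"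
      unfolding qq_powi_add[symmetric] by simp
    finally show ?thesis
      by (simp only: add.assoc)
  qed
  have 3: "m - M + r + 2 * k = m + D + k"
    by (simp add: D_def)
  have 4: "qint (r + k + 1) * qq powi (- m - k) * qint (M - k)
      = qq powi (- m - k) * (qint (r + k + 1) * qint (M - k))"
    by simp
  show ?thesis
    unfolding 4 1 3 2 by (simp add: algebra_simps)
qed

text \<open>This is q^(-mc - c(c-1)/2), written as a product so that consecutive values differ by
  one visible factor.\<close>

definition hw_factor :: "int \<Rightarrow> nat \<Rightarrow> qf" where
  "hw_factor m c = (\<Prod>i<c. qq powi (- m - int i))"

text \<open>The start m - mu is chosen because [m-mu], [m-mu+2], ..., [m+mu] are the eigenvalues of
  t on L(mu). Accordingly the formula gives 0 for n = mu + 1, where every binomial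
  \<open>qbinom (mu - r) (mu + 1 - r)\<close> vanishes. The induction compares both sides after
  multiplication by [n+1].\<close>

lemma act_tshift_hw:
  "act (qint m) mu (tshift (m - int mu) n) (hw mu) r =
     (if r \<le> n \<and> r \<le> mu then hw_factor m (n - r) * qbinom (int mu - int r) (n - r) else 0)"
proof (induction n arbitrary: r)
  case 0
  show ?case
    by (auto simp: hw_def hw_factor_def)
next
  case (Suc n)
  define w where "w = act (qint m) mu (tshift (m - int mu) n) (hw mu)"
  have w: "w r = (if r \<le> n \<and> r \<le> mu then hw_factor m (n - r) * qbinom (int mu - int r) (n - r) else 0)" for r
    unfolding w_def by (rule Suc)
  define y where "y = act (qint m) mu (tshift (m - int mu) (Suc n)) (hw mu) r"
  have "qint (int (Suc n)) * y
     = act (qint m) mu (smult (qint (int (Suc n))) (tshift (m - int mu) (Suc n))) (hw mu) r"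
    by (simp only: act_smult y_def)
  also have "\<dots> = Defs.top (qint m) mu w r - qint (m - int mu + 2 * int n) * w r"
    unfolding tshift_Suc act_mult w_def[symmetric] by (simp add: act_pCons top_eq)
  finally have y: "qint (int (Suc n)) * y
     = Defs.top (qint m) mu w r - qint (m - int mu + 2 * int n) * w r" .
  have "qint (int (Suc n)) * y = qint (int (Suc n)) * (if r \<le> Suc n \<and> r \<le> mu
     then hw_factor m (Suc n - r) * qbinom (int mu - int r) (Suc n - r) else 0)"
  proof -
    consider "r > mu" | "r \<le> mu" "r > Suc n" | "r \<le> mu" "r = Suc n" | "r \<le> mu" "r \<le> n"
      by linarith
    thus ?thesis
    proof cases
      case 4
      define k where "k = n - r"
      define M where "M = int mu - int r"
      have n: "n = r + k"
        using 4 by (simp add: k_def)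
      have mu: "int mu = M + int r"
        using 4 by (simp add: M_def)
      \<comment> \<open>\<open>B\<close> is coordinate r of the n-th vector; the neighbouring
        coordinates are expressed as multiples of it.\<close>
      define B where "B = hw_factor m k * qbinom M k"
      have wr: "w r = B"
        using 4 by (simp add: w B_def M_def k_def)
      \<comment> \<open>The factor [k+1] clears the denominator relating coordinate r - 1 to
        \<open>B\<close>; it is cancelled at the end.\<close>
      have w1: "qint (int r) * w (r - 1) * qint (int k + 1)
          = qint (int r) * qq powi (- m - int k) * qint (M + 1) * B"
      proof (cases r)
        case (Suc r')
        hence "w (r - 1) = hw_factor m (Suc k) * qbinom (M + 1) (Suc k)"
          using 4 by (simp add: w n M_def)
        thus ?thesis
          using qbinom_rec[of k M] by (simp add: hw_factor_def B_def algebra_simps)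
      qed simp
      have w2: "qint M * w (r + 1) = qint (int k) * qq powi (m + int k - 1) * B"
      proof (cases k)
        case 0
        thus ?thesis
          by (simp add: w n)
      next
        case (Suc k')
        show ?thesis
        \<comment> \<open>For M = 0 the index r + 1 lies outside L(mu); the left side vanishes with
          [M] and the right side with \<open>qbinom 0 k\<close>, as k > 0.\<close>
        proof (cases "M = 0")
          case True
          hence "qbinom M k = 0"
            using Suc by (simp add: qbinom_eq_0)
          thus ?thesis
            using True by (simp add: B_def)
        next
          case False
          hence "w (r + 1) = hw_factor m k' * qbinom (M - 1) k'"
            using 4 Suc by (auto simp: w n M_def diff_diff_eq add.commute)
          moreover have "qq powi (m + int k - 1) * hw_factor m k = hw_factor m k'"
            using Suc by (simp add: hw_factor_def qq_powi_add qq_powi_diff power_int_minus field_simps)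
          moreover have "qint M * qbinom (M - 1) k' = qint (int k) * qbinom M k"
            using qbinom_rec[of k' "M - 1"] Suc by simp
          ultimately show ?thesis
            unfolding B_def by (metis (no_types, opaque_lifting) mult.assoc mult.left_commute)
        qed
      qed
      have "Defs.top (qint m) mu w r = qint (int r) * w (r - 1)
          + qq powi (int r + 1 - M) * (qint M * w (r + 1)) + qint m * qq powi (int r - M) * B"
        using 4 by (simp add: top_eq mu wr algebra_simps)
      hence "qint (int k + 1) * (qint (int (Suc n)) * y)
        = qint (int r) * w (r - 1) * qint (int k + 1)
          + qint (int k + 1) * qq powi (int r + 1 - M) * (qint M * w (r + 1))
          + qint (int k + 1) * (qint m * qq powi (int r - M) - qint (m - M + int r + 2 * int k)) * B"
        unfolding y wr by (simp add: mu n algebra_simps)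
      also have "\<dots> = qint (int r + int k + 1) * qq powi (- m - int k) * qint (M - int k) * B"
        unfolding w1 w2 tshift_hw_identity by (simp add: algebra_simps)
      also have "\<dots> = qint (int k + 1) * (qint (int (Suc n)) * (hw_factor m (Suc k) * qbinom M (Suc k)))"
        by (simp add: B_def hw_factor_def qbinom_Suc n algebra_simps)
      finally have "qint (int (Suc n)) * y = qint (int (Suc n)) * (hw_factor m (Suc k) * qbinom M (Suc k))"
        by simp
      thus ?thesis
        using 4 by (simp add: M_def n)
    qed (unfold y, simp_all add: top_eq w hw_factor_def)
  qed
  moreover have "qint (int (Suc n)) \<noteq> 0"
    by (simp only: qint_eq_0_iff of_nat_eq_0_iff)
  ultimately show ?case
    unfolding y_def using mult_left_cancel by blast
qed

section \<open>Integrality\<close>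

lemma LA_add: "u \<in> LA mu \<Longrightarrow> w \<in> LA mu \<Longrightarrow> (\<lambda>a. u a + w a) \<in> LA mu"
  by (auto simp: LA_def inL_def Aset_add)

lemma LA_scale: "c \<in> Aset \<Longrightarrow> w \<in> LA mu \<Longrightarrow> (\<lambda>a. c * w a) \<in> LA mu"
  by (auto simp: LA_def inL_def Aset_mult)

lemma LA_diff: "u \<in> LA mu \<Longrightarrow> w \<in> LA mu \<Longrightarrow> (\<lambda>a. u a - w a) \<in> LA mu"
  by (auto simp: LA_def inL_def Aset_diff)

lemma hw_in_LA: "hw mu \<in> LA mu"
  by (auto simp: LA_def inL_def hw_def)

text \<open>Since m is odd and mu is even, m - mu is odd, so the span may be taken with that
  starting point, where the explicit coordinates are visibly in A.\<close>

lemma tspan_act_hw: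
  assumes "p \<in> tspan s" "odd s" "odd m" "even mu"
  shows "act (qint m) mu p (hw mu) \<in> LA mu"
proof -
  have "p \<in> tspan (m - int mu)"
    using assms tspan_odd[of s "m - int mu"] by auto
  thus ?thesis
  proof induction
    case tspan_0
    thus ?case by (simp add: LA_def inL_def)
  next
    case (tspan_step c p n)
    have "qbinom (int mu - int r) k \<in> Aset" if "r \<le> mu" for r k
      using qbinom_in_Aset[of "mu - r" k] that by (simp add: of_nat_diff)
    moreover have "hw_factor m k \<in> Aset" for k
      unfolding hw_factor_def by (rule Aset_prod) simp
    ultimately have "act (qint m) mu (tshift (m - int mu) n) (hw mu) \<in> LA mu"
      by (auto simp: LA_def inL_def act_tshift_hw Aset_mult)
    thus ?case
      using LA_add[OF tspan_step.IH LA_scale[OF tspan_step.hyps(1)]]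
      by (simp add: act_add[abs_def] act_smult[abs_def])
  qed
qed

lemma act_poly_sum: "act kappa mu (\<Sum>i\<in>I. smult (c i) (P i)) w a = (\<Sum>i\<in>I. c i * act kappa mu (P i) w a)"
  by (induction I rule: infinite_finite_induct) (simp_all add: act_add act_smult)

lemma tspan_sum: "(\<And>i. i \<in> I \<Longrightarrow> f i \<in> tspan s) \<Longrightarrow> sum f I \<in> tspan s"
  by (induction I rule: infinite_finite_induct) (auto intro: tspan_add tspan_0)

text \<open>The vector obtained from \<open>tshift (m - mu) r\<close> has coordinate 1 at r,
  integral coordinates below and none above. Subtracting the lower terms, which are available by
  induction, isolates F^(r) v.\<close>

lemma basis_vector_in_tspan_hw:
  assumes "odd m" "even mu" "r \<le> mu"
  shows "\<exists>p\<in>tspan (m - int mu). act (qint m) mu p (hw mu) = (\<lambda>a. if a = r then 1 else 0)"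
  using assms(3)
proof (induction r rule: less_induct)
  case (less r)
  define X where "X = act (qint m) mu (tshift (m - int mu) r) (hw mu)"
  have "X \<in> LA mu"
    unfolding X_def using assms by (intro tspan_act_hw[OF tspan_tshift]) auto
  hence X: "X i \<in> Aset" for i
    by (auto simp: LA_def)
  have "\<forall>i<r. \<exists>p. p \<in> tspan (m - int mu) \<and> act (qint m) mu p (hw mu) = (\<lambda>a. if a = i then 1 else 0)"
    using less by (meson less_imp_le order.trans)
  then obtain P where P: "\<And>i. i < r \<Longrightarrow> P i \<in> tspan (m - int mu)"
    "\<And>i. i < r \<Longrightarrow> act (qint m) mu (P i) (hw mu) = (\<lambda>a. if a = i then 1 else 0)"
    by metis
  define p where "p = tshift (m - int mu) r - (\<Sum>i<r. smult (X i) (P i))"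
  have "p \<in> tspan (m - int mu)"
    unfolding p_def by (intro tspan_diff tspan_tshift tspan_sum tspan_smult) (auto simp: P X)
  moreover have "act (qint m) mu p (hw mu) a = (if a = r then 1 else 0)" for a
  proof -
    have "(\<Sum>i<r. X i * act (qint m) mu (P i) (hw mu) a) = (\<Sum>i<r. if a = i then X i else 0)"
      by (intro sum.cong) (auto simp: P)
    also have "\<dots> = (if a < r then X a else 0)"
      by simp
    finally have "act (qint m) mu p (hw mu) a = X a - (if a < r then X a else 0)"
      by (simp add: p_def act_diff act_poly_sum X_def)
    thus ?thesis
      using less.prems by (auto simp: X_def act_tshift_hw hw_factor_def)
  qed
  ultimately show ?case
    by blast
qed

text \<open>Each F^(r) v is P_r v with P_r in the span. Hence p F^(r) v = (p P_r) v, and closure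
  under products reduces integrality on all of L(mu) to integrality on v.\<close>

lemma tspan_subset_AUev:
  assumes "p \<in> tspan s" "odd s" "odd m"
  shows "p \<in> AUev (qint m)"
  unfolding AUev_def
proof (intro CollectI allI impI ballI)
  fix mu :: nat and w assume mu: "even mu" and w: "w \<in> LA mu"
  obtain P where P: "\<And>r. r \<le> mu \<Longrightarrow> P r \<in> tspan (m - int mu)"
    "\<And>r. r \<le> mu \<Longrightarrow> act (qint m) mu (P r) (hw mu) = (\<lambda>a. if a = r then 1 else 0)"
    using basis_vector_in_tspan_hw[OF assms(3) mu] by metis
  have p: "p \<in> tspan (m - int mu)"
    using assms mu tspan_odd[of s "m - int mu"] by auto
  have "w = (\<lambda>a. \<Sum>r\<le>mu. w r * (if a = r then 1 else 0))"
  proof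
    fix a
    have "(\<Sum>r\<le>mu. w r * (if a = r then 1 else 0)) = (\<Sum>r\<le>mu. if a = r then w r else 0)"
      by (intro sum.cong) auto
    thus "w a = (\<Sum>r\<le>mu. w r * (if a = r then 1 else 0))"
      using w by (auto simp: LA_def inL_def)
  qed
  hence "act (qint m) mu p w a = (\<Sum>r\<le>mu. w r * act (qint m) mu (p * P r) (hw mu) a)" for a
    using act_sum[of "qint m" mu p w "\<lambda>r a. if a = r then 1 else 0" "{..mu}" a]
    by (simp add: act_mult P)
  moreover have "act (qint m) mu (p * P r) (hw mu) \<in> LA mu" if "r \<le> mu" for r
    using assms mu that by (intro tspan_act_hw[OF tspan_mult[OF p P(1)]]) auto
  ultimately have "act (qint m) mu p w a \<in> Aset" for a
    using w by (auto simp: LA_def intro!: Aset_sum Aset_mult)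
  thus "act (qint m) mu p w \<in> LA mu"
    using w by (auto simp: LA_def act_inL)
qed

section \<open>The divided powers\<close>

lemma tdot_prod:
  "(\<Prod>j\<in>{1 - int a .. int a}. [:- qint (2 * j - 1), 1:])
   = (\<Prod>i<2 * a. [:- qint (1 - 2 * int a + 2 * int i), 1:])"
  by (rule prod.reindex_bij_witness[of _ "\<lambda>i. int i - int a + 1" "\<lambda>j. nat (j + int a - 1)"])
     (auto simp: algebra_simps)

lemma tdot_even: "tdot (2 * a) = tshift (1 - 2 * int a) (2 * a)"
  by (simp add: tdot_def Let_def tdot_prod tshift_def)

lemma tdot_Suc_even: "smult (qint (int (Suc (2 * a)))) (tdot (Suc (2 * a))) = [:0, 1:] * tdot (2 * a)"
proof -
  have "qint (int (Suc (2 * a))) * inverse (qfact (Suc (2 * a))) = inverse (qfact (2 * a))"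
    by (simp add: qfact_Suc)
  thus ?thesis
    unfolding tdot_even tshift_def tdot_def Let_def by (simp add: tdot_prod del: of_nat_Suc)
qed

text \<open>Passing from a to a + 1 adds the two roots h and -h with h = [2a+1], so the product
  gains the factor t^2 - h^2. The term t^2 belongs to t \<open>tdot (2a+1)\<close> and the term h^2
  to h \<open>tdot (2a)\<close>.\<close>

lemma tdot_Suc_odd:
  "smult (qint (int (Suc (Suc (2 * a))))) (tdot (Suc (Suc (2 * a))))
   = [:0, 1:] * tdot (Suc (2 * a)) - smult (qint (int (Suc (2 * a)))) (tdot (2 * a))"
proof -
  define Q where "Q = (\<Prod>i<2 * a. [:- qint (1 - 2 * int a + 2 * int i), 1:])"
  define h where "h = qint (int (Suc (2 * a)))"
  define g where "g = inverse (qfact (Suc (2 * a)))"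
  have "(\<Prod>i<2 * Suc a. [:- qint (1 - 2 * int (Suc a) + 2 * int i), 1:])
      = [:h, 1:] * (\<Prod>i<Suc (2 * a). [:- qint (1 - 2 * int a + 2 * int i), 1:])"
  proof -
    have "2 * Suc a = Suc (Suc (2 * a))"
      by simp
    moreover have "- qint (1 - 2 * int (Suc a) + 2 * int 0) = h"
      using qint_minus[of "int (Suc (2 * a))"] by (simp add: h_def algebra_simps)
    moreover have "1 - 2 * int (Suc a) + 2 * int (Suc i) = 1 - 2 * int a + 2 * int i" for i
      by simp
    ultimately show ?thesis
      by (simp only: prod.lessThan_Suc_shift[of _ "Suc (2 * a)"] o_def)
  qed
  also have "(\<Prod>i<Suc (2 * a). [:- qint (1 - 2 * int a + 2 * int i), 1:]) = Q * [:- h, 1:]"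
    by (simp add: Q_def h_def add.commute)
  finally have Q: "(\<Prod>i<2 * Suc a. [:- qint (1 - 2 * int (Suc a) + 2 * int i), 1:]) = [:h, 1:] * (Q * [:- h, 1:])" .
  have 1: "smult (qint (int (Suc (Suc (2 * a))))) (tdot (Suc (Suc (2 * a)))) = smult g ([:h, 1:] * (Q * [:- h, 1:]))"
  proof -
    have "tdot (Suc (Suc (2 * a))) = smult (inverse (qfact (Suc (Suc (2 * a))))) ([:h, 1:] * (Q * [:- h, 1:]))"
      using tdot_even[of "Suc a"] unfolding tshift_def Q by simp
    moreover have "qint (int (Suc (Suc (2 * a)))) * inverse (qfact (Suc (Suc (2 * a)))) = g"
      unfolding g_def qfact_Suc[of "Suc (2 * a)"] by simp
    ultimately show ?thesis
      by (simp only: smult_smult)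
  qed
  have 2: "tdot (Suc (2 * a)) = smult g ([:0, 1:] * Q)"
    unfolding tdot_def Let_def by (simp add: tdot_prod Q_def g_def)
  have 3: "tdot (2 * a) = smult (g * h) Q"
    unfolding tdot_even tshift_def by (simp add: Q_def g_def h_def qfact_Suc mult_ac)
  show ?thesis
    unfolding 1 2 3 h_def[symmetric] by (simp add: algebra_simps smult_add_right smult_diff_right)
qed

text \<open>For even index this is a shifted divided power with odd start. For odd index, replacing
  the root 0 by [2a+1] changes \<open>tdot (2a+1)\<close> exactly by
  \<open>tdot (2a)\<close>.\<close>

lemma tdot_in_tspan: "tdot n \<in> tspan 1"
proof -
  define a where "a = n div 2"
  have eq: "tspan (1 - 2 * int a) = tspan 1"
    by (rule tspan_odd) auto
  have ev: "tdot (2 * a) \<in> tspan 1"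
    using tspan_tshift[of "1 - 2 * int a" "2 * a"] by (simp add: tdot_even eq)
  show ?thesis
  proof (cases "even n")
    case True
    thus ?thesis
      using ev by (simp add: a_def)
  next
    case False
    hence n: "n = Suc (2 * a)"
      by (simp add: a_def)
    define h where "h = qint (int (Suc (2 * a)))"
    have "h \<noteq> 0"
      by (simp add: h_def)
    have "smult h (tshift (1 - 2 * int a) (Suc (2 * a))) = [:- h, 1:] * tdot (2 * a)"
      using tshift_Suc[of "2 * a" "1 - 2 * int a"] unfolding tdot_even h_def by (simp add: add.commute)
    also have "\<dots> = smult h (tdot n) - smult h (tdot (2 * a))"
      using tdot_Suc_even[of a] unfolding n h_def by simp
    also have "\<dots> = smult h (tdot n - tdot (2 * a))"
      by (simp add: smult_diff_right)
    finally have "smult (inverse h) (smult h (tshift (1 - 2 * int a) (Suc (2 * a))))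
        = smult (inverse h) (smult h (tdot n - tdot (2 * a)))"
      by (rule arg_cong)
    hence "tdot n = tshift (1 - 2 * int a) (Suc (2 * a)) + tdot (2 * a)"
      using \<open>h \<noteq> 0\<close> by simp
    thus ?thesis
      using ev tspan_tshift[of "1 - 2 * int a" "Suc (2 * a)"] by (auto simp: eq intro: tspan_add)
  qed
qed

lemma tdot_0 [simp]: "tdot 0 = 1"
  using tdot_even[of 0] by simp

text \<open>One recursion for both parities, the form in which limits are taken later. The index n -
  1 is used only for odd n, so the subtraction is never truncated there.\<close>

lemma tdot_Suc:
  "smult (qint (int (Suc n))) (tdot (Suc n))
   = [:0, 1:] * tdot n - (if odd n then smult (qint (int n)) (tdot (n - 1)) else 0)"
proof (cases "even n")
  case True
  then obtain a where "n = 2 * a" by (elim evenE)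
  thus ?thesis
    using tdot_Suc_even[of a] by simp
next
  case False
  then obtain a where "n = Suc (2 * a)" by (metis oddE Suc_eq_plus1)
  thus ?thesis
    using tdot_Suc_odd[of a] by simp
qed

lemma tdot_coeff: "(\<forall>i>n. coeff (tdot n) i = 0) \<and> coeff (tdot n) n * qfact n = 1"
proof (induction n rule: less_induct)
  case (less n)
  show ?case
  proof (cases n)
    case 0
    thus ?thesis by (auto simp: coeff_eq_0)
  next
    case (Suc k)
    have rec: "qint (int (Suc k)) * coeff (tdot (Suc k)) (Suc i)
      = coeff (tdot k) i - (if odd k then qint (int k) * coeff (tdot (k - 1)) (Suc i) else 0)" for i
      using arg_cong[OF tdot_Suc[of k], of "\<lambda>p. coeff p (Suc i)"] by (simp split: if_splits)
    have IH: "\<forall>i>k. coeff (tdot k) i = 0" "coeff (tdot k) k * qfact k = 1" "\<forall>i>k - 1. coeff (tdot (k - 1)) i = 0"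
      using less[of k] less[of "k - 1"] Suc by auto
    have "coeff (tdot n) i = 0" if i: "i > n" for i
    proof -
      obtain j where j: "i = Suc j"
        using i by (cases i) auto
      have "j > k"
        using i Suc j by simp
      thus ?thesis
        using rec[of j] IH Suc j by (auto split: if_splits)
    qed
    moreover have "coeff (tdot n) n * qfact n = 1"
      using rec[of k] IH Suc by (auto simp: qfact_Suc mult_ac split: if_splits)
    ultimately show ?thesis
      by blast
  qed
qed

lemma degree_tdot_le: "degree (tdot n) \<le> n"
  using tdot_coeff[of n] by (intro degree_le) auto

lemma psiU_tdot: "psiU (tdot n) = tdot n"
  unfolding tdot_def Let_def
  by (simp add: psiU_smult psiU_mult psiU_prod psiU_pCons qbar_uminus qbar_inverse del: mult_pCons_left)

section \<open>The divided powers as an A-basis of the integral form\<close>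

lemma tdot_in_AUev: "odd m \<Longrightarrow> tdot n \<in> AUev (qint m)"
  using tspan_subset_AUev[OF tdot_in_tspan] by simp

text \<open>Testing x on the highest weight vector of L(2d) suffices: the weight 2d is even and at
  least d, so coordinate d of x v is the leading coefficient times [d]!.\<close>

lemma AUev_leading_coeff:
  assumes "x \<in> AUev kappa" "degree x \<le> d"
  shows "coeff x d * qfact d \<in> Aset"
proof -
  have "act kappa (2 * d) x (hw (2 * d)) \<in> LA (2 * d)"
    using assms(1) hw_in_LA[of "2 * d"] by (auto simp: AUev_def)
  thus ?thesis
    using act_hw_top_coeff(2)[OF assms(2), of "2 * d" kappa] by (auto simp: LA_def dest: spec[of _ d])
qed

lemma AUev_diff_smult:
  assumes "x \<in> AUev kappa" "y \<in> AUev kappa" "c \<in> Aset"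
  shows "x - smult c y \<in> AUev kappa"
  unfolding AUev_def
proof (intro CollectI allI impI ballI)
  fix mu :: nat and w assume "even mu" "w \<in> LA mu"
  hence "act kappa mu x w \<in> LA mu" "act kappa mu y w \<in> LA mu"
    using assms by (auto simp: AUev_def)
  from LA_diff[OF this(1) LA_scale[OF assms(3) this(2)]] show "act kappa mu (x - smult c y) w \<in> LA mu"
    by (simp add: act_diff[abs_def] act_smult)
qed

text \<open>Leading terms are peeled off one at a time. As \<open>tdot d\<close> has leading
  coefficient 1/[d]!, the multiplier needed is the integral element of
  \<open>AUev_leading_coeff\<close>. The bound d on the degree is strict, so that d = 0 means x =
  0.\<close>

lemma AUev_tdot_expansion:
  assumes "odd m" "x \<in> AUev (qint m)" "\<And>i. i \<ge> d \<Longrightarrow> coeff x i = 0"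
  shows "\<exists>c. (\<forall>n. c n \<in> Aset) \<and> (\<forall>n\<ge>d. c n = 0) \<and> x = (\<Sum>n<d. smult (c n) (tdot n))"
  using assms(2,3)
proof (induction d arbitrary: x)
  case 0
  hence "x = 0"
    by (intro poly_eqI) auto
  thus ?case
    by (intro exI[of _ "\<lambda>_. 0"]) auto
next
  case (Suc d)
  define e where "e = coeff x d * qfact d"
  define y where "y = x - smult e (tdot d)"
  have "degree x \<le> d"
    using Suc.prems by (intro degree_le) auto
  hence e: "e \<in> Aset"
    unfolding e_def using Suc.prems(1) by (intro AUev_leading_coeff)
  hence "y \<in> AUev (qint m)"
    unfolding y_def using Suc.prems(1) assms(1) by (intro AUev_diff_smult tdot_in_AUev)
  moreover have "coeff y i = 0" if "i \<ge> d" for i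
  proof (cases "i = d")
    case True
    thus ?thesis
      using tdot_coeff[of d] by (simp add: y_def e_def mult.assoc mult.commute[of "qfact d"])
  next
    case False
    thus ?thesis
      using that tdot_coeff[of d] Suc.prems(2)[of i] by (simp add: y_def)
  qed
  ultimately obtain c where c: "\<forall>n. c n \<in> Aset" "\<forall>n\<ge>d. c n = 0" "y = (\<Sum>n<d. smult (c n) (tdot n))"
    using Suc.IH by blast
  have "x = (\<Sum>n<d. smult (c n) (tdot n)) + smult e (tdot d)"
    using c(3) by (simp add: y_def algebra_simps)
  also have "(\<Sum>n<d. smult (c n) (tdot n)) = (\<Sum>n<d. smult ((c(d := e)) n) (tdot n))"
    by (intro sum.cong) auto
  finally show ?case
    using c e by (intro exI[of _ "c(d := e)"]) auto
qed

lemma tdot_linear_independent: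
  assumes "(\<Sum>n<D. smult (c n) (tdot n)) = 0" "n < D"
  shows "c n = 0"
  using assms
proof (induction D)
  case (Suc D)
  have "coeff (\<Sum>n<D. smult (c n) (tdot n)) D = 0"
    using tdot_coeff by (simp add: coeff_sum)
  hence "c D * coeff (tdot D) D = 0"
    using arg_cong[OF Suc.prems(1), of "\<lambda>p. coeff p D"] by simp
  hence "c D = 0"
    using tdot_coeff[of D] by auto
  thus ?case
    using Suc by (cases "n = D") auto
qed simp

lemma tdot_A_basis:
  assumes "odd m"
  shows "is_A_basis tdot (AUev (qint m))"
  unfolding is_A_basis_def
proof (intro conjI allI ballI)
  fix n show "tdot n \<in> AUev (qint m)"
    using assms by (rule tdot_in_AUev)
next
  fix x assume x: "x \<in> AUev (qint m)"
  \<comment> \<open>Sums over supports become sums over initial segments, so that two coefficient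
    families can be subtracted over a common bound.\<close>
  have support: "(\<Sum>n\<in>{n. c n \<noteq> 0}. smult (c n) (tdot n)) = (\<Sum>n<D. smult (c n) (tdot n))"
    if "\<forall>n\<ge>D. c n = 0" for c D
    using that by (intro sum.mono_neutral_left) (auto simp: not_le[symmetric])
  obtain d where "\<And>i. i \<ge> d \<Longrightarrow> coeff x i = 0"
    using coeff_eq_0[of x] Suc_le_lessD by blast
  from AUev_tdot_expansion[OF assms x this]
  obtain c where c: "\<forall>n. c n \<in> Aset" "\<forall>n\<ge>d. c n = 0"
    "x = (\<Sum>n<d. smult (c n) (tdot n))"
    by blast
  have fin: "finite {n. c n \<noteq> 0}"
    by (rule finite_subset[of _ "{..<d}"]) (use c(2) in \<open>auto simp: not_le[symmetric]\<close>)
  show "\<exists>!c. (\<forall>n. c n \<in> Aset) \<and> finite {n. c n \<noteq> 0} \<and>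
      x = (\<Sum>n\<in>{n. c n \<noteq> 0}. smult (c n) (tdot n))"
  proof (rule ex1I[of _ c])
    show "(\<forall>n. c n \<in> Aset) \<and> finite {n. c n \<noteq> 0} \<and> x = (\<Sum>n\<in>{n. c n \<noteq> 0}. smult (c n) (tdot n))"
      using c fin support[OF c(2)] by metis
  next
    fix c' assume c': "(\<forall>n. c' n \<in> Aset) \<and> finite {n. c' n \<noteq> 0} \<and>
      x = (\<Sum>n\<in>{n. c' n \<noteq> 0}. smult (c' n) (tdot n))"
    obtain D' where D': "\<forall>n\<in>{n. c' n \<noteq> 0}. n < D'"
      using c' finite_nat_set_iff_bounded by blast
    define D where "D = max D' d"
    have D: "\<forall>n\<ge>D. c n = 0" "\<forall>n\<ge>D. c' n = 0"
      using c(2) D' by (auto simp: D_def)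
    have "(\<Sum>n<D. smult (c' n) (tdot n)) = x" "(\<Sum>n<D. smult (c n) (tdot n)) = x"
      using c(3) c' support[OF D(1)] support[OF D(2)] support[OF c(2)] by argo+
    hence "(\<Sum>n<D. smult (c' n - c n) (tdot n)) = 0"
      by (simp add: smult_diff_left sum_subtractf)
    hence "c' n - c n = 0" if "n < D" for n
      using tdot_linear_independent[of "\<lambda>n. c' n - c n" D] that by blast
    thus "c' = c"
      using D by (intro ext) (metis right_minus_eq not_le)
  qed
qed

section \<open>The bar involution on \<open>L(\<mu>)\<close>\<close>

text \<open>The annihilator of the highest weight vector is generated by a product of factors
  \<open>t - [k]\<close>, hence it is bar invariant. This is what makes \<open>psiL\<close> well defined.\<close>

lemma psiU_annihilator:
  assumes "act (qint m) mu p (hw mu) = (\<lambda>a. 0)"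
  shows "act (qint m) mu (psiU p) (hw mu) = (\<lambda>a. 0)"
proof -
  define Z where "Z = tshift (m - int mu) (Suc mu)"
  have degZ: "degree Z = Suc mu"
    unfolding Z_def tshift_def by (simp add: degree_prod_sum_eq del: prod.lessThan_Suc)
  hence "Z \<noteq> 0"
    by auto
  have Z: "act (qint m) mu Z (hw mu) a = 0" for a
    by (auto simp: Z_def act_tshift_hw qbinom_eq_0)
  have Z': "act (qint m) mu (g * Z) (hw mu) a = 0" for g a
  proof -
    \<comment> \<open>The zero vector is written as an empty linear combination, to which
      \<open>act_sum\<close> applies.\<close>
    have "act (qint m) mu Z (hw mu) = (\<lambda>a. \<Sum>i\<in>{}. 0 * hw mu a)"
      by (rule ext) (simp add: Z)
    thus ?thesis
      using act_sum[of "qint m" mu g "\<lambda>i. 0" "\<lambda>i. hw mu" "{}" a] by (simp add: act_mult)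
  qed
  \<comment> \<open>The remainder has degree at most mu and also kills v, so coordinate
    \<open>degree h\<close> of h v forces its leading coefficient to be 0.\<close>
  define h where "h = p mod Z"
  have p: "p = p div Z * Z + h"
    by (simp add: h_def)
  have "degree h \<le> mu"
    using degree_mod_less'[OF \<open>Z \<noteq> 0\<close>, of p] degZ unfolding h_def by (cases "p mod Z = 0") auto
  moreover have "act (qint m) mu h (hw mu) a = 0" for a
    using assms Z'[of "p div Z" a] act_add[of "qint m" mu "p div Z * Z" h "hw mu" a] p by simp
  ultimately have "lead_coeff h * qfact (degree h) = 0"
    using act_hw_top_coeff(2)[of h "degree h" mu "qint m"] by simp
  hence "p = p div Z * Z"
    using p by simp
  hence "psiU p = psiU (p div Z) * Z"
    by (metis Z_def psiU_mult psiU_tshift)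
  thus ?thesis
    using Z' by (intro ext) simp
qed

text \<open>The choice in \<open>psiL\<close> is unambiguous: two polynomials representing the same
  vector differ by an element of the annihilator of v, which \<open>psiU\<close> preserves.\<close>

lemma psiL_act_hw:
  assumes "psiU p = p"
  shows "psiL (qint m) mu (act (qint m) mu p (hw mu)) = act (qint m) mu p (hw mu)"
  unfolding psiL_def
proof (rule some_equality)
  show "\<exists>r. act (qint m) mu p (hw mu) = act (qint m) mu r (hw mu) \<and>
      act (qint m) mu p (hw mu) = act (qint m) mu (psiU r) (hw mu)"
    using assms by (intro exI[of _ p]) simp
next
  fix y assume "\<exists>r. act (qint m) mu p (hw mu) = act (qint m) mu r (hw mu) \<and>
      y = act (qint m) mu (psiU r) (hw mu)"
  then obtain r where r: "act (qint m) mu p (hw mu) = act (qint m) mu r (hw mu)"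
    "y = act (qint m) mu (psiU r) (hw mu)"
    by blast
  have "act (qint m) mu (r - p) (hw mu) = (\<lambda>a. 0)"
    by (rule ext) (simp add: act_diff r)
  hence "act (qint m) mu (psiU (r - p)) (hw mu) = (\<lambda>a. 0)"
    by (rule psiU_annihilator)
  moreover have "psiU (r - p) = psiU r - p"
    using psiU_add[of "r - p" p] assms by (simp add: algebra_simps)
  ultimately have "act (qint m) mu (psiU r) (hw mu) a - act (qint m) mu p (hw mu) a = 0" for a
    by (metis act_diff)
  thus "y = act (qint m) mu p (hw mu)"
    unfolding r(2) by (intro ext) simp
qed

section \<open>Stabilisation of coordinates for large weights\<close>

text \<open>Convergence in the q^-1-adic topology with error of degree at most C - mu. This linear
  rate is stable under sums and products; one constant serves both as threshold and as bound, and
  \<open>qlimI\<close> allows two.\<close>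

definition qlim :: "(nat \<Rightarrow> qf) \<Rightarrow> qf \<Rightarrow> bool" where
  "qlim f x \<longleftrightarrow> (\<exists>C. \<forall>mu\<ge>C. f mu - x \<in> deg_le (int C - int mu))"

lemma qlimI:
  assumes "\<And>mu. mu \<ge> C0 \<Longrightarrow> f mu - x \<in> deg_le (C - int mu)"
  shows "qlim f x"
proof -
  define D where "D = max C0 (nat C)"
  have "f mu - x \<in> deg_le (int D - int mu)" if "mu \<ge> D" for mu
    by (rule deg_le_mono[OF assms]) (use that in \<open>auto simp: D_def\<close>)
  thus ?thesis
    unfolding qlim_def by blast
qed

lemma qlim_const: "qlim (\<lambda>_. x) x"
  by (rule qlimI[of 0 _ _ 0]) simp

lemma qlim_cong:
  assumes "qlim f x" "\<And>mu. mu \<ge> C0 \<Longrightarrow> g mu = f mu"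
  shows "qlim g x"
proof -
  obtain C where C: "\<And>mu. mu \<ge> C \<Longrightarrow> f mu - x \<in> deg_le (int C - int mu)"
    using assms(1) by (auto simp: qlim_def)
  show ?thesis
    by (rule qlimI[of "max C C0" _ _ "int C"]) (simp add: assms(2) C)
qed

lemma qlim_add:
  assumes "qlim f x" "qlim g y"
  shows "qlim (\<lambda>mu. f mu + g mu) (x + y)"
proof -
  obtain C where C: "\<And>mu. mu \<ge> C \<Longrightarrow> f mu - x \<in> deg_le (int C - int mu)"
    using assms(1) by (auto simp: qlim_def)
  obtain D where D: "\<And>mu. mu \<ge> D \<Longrightarrow> g mu - y \<in> deg_le (int D - int mu)"
    using assms(2) by (auto simp: qlim_def)
  show ?thesis
  proof (rule qlimI[of "max C D" _ _ "int (max C D)"])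
    fix mu assume mu: "mu \<ge> max C D"
    have "(f mu - x) + (g mu - y) \<in> deg_le (int (max C D) - int mu)"
      using mu by (intro deg_le_add deg_le_mono[OF C] deg_le_mono[OF D]) auto
    thus "f mu + g mu - (x + y) \<in> deg_le (int (max C D) - int mu)"
      by (simp add: algebra_simps)
  qed
qed

lemma qlim_mult:
  assumes "qlim f x" "qlim g y"
  shows "qlim (\<lambda>mu. f mu * g mu) (x * y)"
proof -
  obtain C where C: "\<And>mu. mu \<ge> C \<Longrightarrow> f mu - x \<in> deg_le (int C - int mu)"
    using assms(1) by (auto simp: qlim_def)
  obtain D where D: "\<And>mu. mu \<ge> D \<Longrightarrow> g mu - y \<in> deg_le (int D - int mu)"
    using assms(2) by (auto simp: qlim_def)
  obtain i j where x: "x \<in> deg_le (int i)" and y: "y \<in> deg_le (int j)"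
    using deg_le_exists by metis
  define E where "E = C + D + i + j"
  show ?thesis
  proof (rule qlimI[of E _ _ "int E"])
    fix mu assume mu: "mu \<ge> E"
    hence *: "mu \<ge> C" "mu \<ge> D"
      by (auto simp: E_def)
    have "(f mu - x) * (g mu - y) + ((f mu - x) * y + x * (g mu - y)) \<in> deg_le (int E - int mu)"
      using mu by (intro deg_le_add deg_le_mono[OF deg_le_mult[OF C[OF *(1)] D[OF *(2)]]]
          deg_le_mono[OF deg_le_mult[OF C[OF *(1)] y]] deg_le_mono[OF deg_le_mult[OF x D[OF *(2)]]])
        (auto simp: E_def)
    thus "f mu * g mu - x * y \<in> deg_le (int E - int mu)"
      by (simp add: algebra_simps)
  qed
qed

lemma qlim_qq_powi_0: "qlim (\<lambda>mu. qq powi (k - int mu)) 0"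
  by (rule qlimI[of 0 _ _ k]) (simp add: deg_le_qq_powi)

text \<open>This is the matrix coefficient of the E-part of t from index r + 1 to r; it equals
  \<open>qdel\<close> (q^(r+1) - q^(3r+1-2mu)).\<close>

lemma qlim_raising:
  "qlim (\<lambda>mu. qq powi (2 * int r + 1 - int mu) * qint (int mu - int r)) (qdel * qq powi (int r + 1))"
proof -
  have "qlim (\<lambda>mu. qdel * qq powi (int r + 1) + (- qdel * qq powi (2 * int r + 1 - int mu)) * qq powi (int r - int mu))
     (qdel * qq powi (int r + 1) + (- qdel * 0) * 0)"
    by (intro qlim_add qlim_mult qlim_const qlim_qq_powi_0)
  moreover have "qq powi (2 * int r + 1 - int mu) * qint (int mu - int r)
     = qdel * qq powi (int r + 1) + (- qdel * qq powi (2 * int r + 1 - int mu)) * qq powi (int r - int mu)" for mu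
  proof -
    have "qq powi (int r + 1) = qq powi (2 * int r + 1 - int mu) * qq powi (int mu - int r)"
      unfolding qq_powi_add[symmetric] by simp
    moreover have "inverse (qq powi (int mu - int r)) = qq powi (int r - int mu)"
      by (simp flip: power_int_minus)
    ultimately show ?thesis
      unfolding qint_conv by (simp add: algebra_simps)
  qed
  ultimately show ?thesis
    by simp
qed

text \<open>The limit as \<open>\<mu> \<rightarrow> \<infinity>\<close> of the coordinate of \<open>tdot n v\<close> at \<open>F^(n - 2 c) v\<close> is \<open>tlim n c\<close>;
  it was found by solving the limit of the recursion \<open>tdot_Suc\<close>.\<close>

definition qden :: "nat \<Rightarrow> qf" where
  "qden c = (\<Prod>i<c. qq powi (2 * int (Suc i)) - qq powi (- (2 * int (Suc i))))"

definition tlim :: "nat \<Rightarrow> nat \<Rightarrow> qf" where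
  "tlim n c = qq powi ((if odd n then 2 * int c else 0) - int c * int c) / qden c"

lemma qden_Suc: "qden (Suc c) = qden c * (qq powi (2 * int (Suc c)) - qq powi (- (2 * int (Suc c))))"
  by (simp add: qden_def)

lemma qq_diff_Suc_nonzero: "qq powi (2 * int (Suc c)) - qq powi (- (2 * int (Suc c))) \<noteq> 0"
  by (simp only: qq_powi_diff_eq_0_iff) simp

lemma qden_nonzero: "qden c \<noteq> 0"
proof (induction c)
  case (Suc c)
  thus ?case
    unfolding qden_Suc by (rule no_zero_divisors[OF _ qq_diff_Suc_nonzero])
qed (simp add: qden_def)

text \<open>Each of the c factors of \<open>qden c\<close> lowers the degree by at least 2, which
  offsets the possible summand 2c; at most -c^2 remains.\<close>

lemma tlim_deg:
  assumes "c > 0"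
  shows "tlim n c \<in> deg_le (- 1)"
proof -
  have "inverse (qden c) \<in> deg_le (- 2 * int c)"
  proof (induction c)
    case 0
    thus ?case
      using deg_le_qq_powi[of 0] by (simp add: qden_def)
  next
    case (Suc c)
    have "inverse (qq powi (2 * int (Suc c)) - qq powi (- (2 * int (Suc c)))) \<in> deg_le (- 2)"
      by (rule deg_le_mono[OF deg_le_inverse_qq_diff]) auto
    from deg_le_mult[OF Suc this] show ?case
      by (simp only: qden_Suc inverse_mult_distrib) (simp add: algebra_simps)
  qed
  from deg_le_mult[OF deg_le_qq_powi this]
  have "tlim n c \<in> deg_le ((if odd n then 2 * int c else 0) - int c * int c + - 2 * int c)"
    unfolding tlim_def divide_inverse .
  moreover have "int c * int c \<ge> 1"
    using mult_mono[of 1 "int c" 1 "int c"] assms by simp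
  ultimately show ?thesis
    by (elim deg_le_mono) auto
qed

text \<open>With A = q^(n+1), C = q^(c+1) and G = q^(-(c+1)^2), all terms share the factor
  \<open>qdel * G / (P * d)\<close>. What remains is an elementary identity in A, C and q, one for
  each parity of n.\<close>

lemma tlim_rec:
  "qint (int (Suc n)) * tlim (Suc n) (Suc c)
   = qint (int n - 2 * int c - 1) * tlim n (Suc c) + qdel * qq powi (int n - 2 * int c) * tlim n c
     - (if odd n then qint (int n) * tlim (n - 1) c else 0)"
proof -
  define C where "C = qq powi int (Suc c)"
  define A where "A = qq powi int (Suc n)"
  define G where "G = qq powi (- (int (Suc c) * int (Suc c)))"
  define P where "P = qden c"
  define d where "d = C * C - inverse (C * C)"
  have "qq powi (2 * int (Suc c)) = C * C"
    unfolding C_def mult_2 qq_powi_add ..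
  hence CC: "qq powi (2 * int (Suc c)) = C * C" "qq powi (- (2 * int (Suc c))) = inverse (C * C)"
    by (simp_all only: power_int_minus)
  have nz: "C \<noteq> 0" "A \<noteq> 0" "P \<noteq> 0" "d \<noteq> 0"
    using qq_diff_Suc_nonzero[of c] unfolding CC
    by (auto simp: C_def A_def P_def qden_nonzero d_def)
  have den: "qden (Suc c) = P * d"
    unfolding qden_Suc CC P_def d_def ..
  have A1: "qq powi int n = A / qq"
    by (simp add: A_def qq_powi_add)
  have A2: "qq powi (int n - 2 * int c - 1) = A / (C * C)"
  proof -
    have "int n - 2 * int c - 1 = int (Suc n) - 2 * int (Suc c)"
      by simp
    thus ?thesis
      by (simp only: qq_powi_diff CC A_def)
  qed
  have A3: "qq powi (int n - 2 * int c) = A * qq / (C * C)"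
  proof -
    have "int n - 2 * int c = int (Suc n) + 1 - 2 * int (Suc c)"
      by simp
    thus ?thesis
      by (simp only: qq_powi_diff qq_powi_add CC A_def power_int_1_right)
  qed
  have G0: "qq powi (- (int c * int c)) = G * (C * C) / qq"
  proof -
    have "- (int c * int c) = - (int (Suc c) * int (Suc c)) + 2 * int (Suc c) - 1"
      by (simp add: algebra_simps)
    thus ?thesis
      by (simp only: qq_powi_diff qq_powi_add CC G_def power_int_1_right)
  qed
  have G1: "qq powi (2 * int c - int c * int c) = G * (C * C) * (C * C) / (qq * qq * qq)"
  proof -
    have "2 * int c - int c * int c = - (int c * int c) + 2 * int (Suc c) - (1 + 1)"
      by simp
    hence "qq powi (2 * int c - int c * int c) = G * (C * C) / qq * (C * C) / (qq * qq)"
      by (simp only: qq_powi_diff qq_powi_add CC G0 power_int_1_right)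
    thus ?thesis
      by simp
  qed
  have G2: "qq powi (2 * int (Suc c) - int (Suc c) * int (Suc c)) = G * (C * C)"
  proof -
    have "2 * int (Suc c) - int (Suc c) * int (Suc c) = - (int (Suc c) * int (Suc c)) + 2 * int (Suc c)"
      by simp
    thus ?thesis
      by (simp only: qq_powi_add CC G_def)
  qed
  show ?thesis
  proof (cases "even n")
    case True
    have "(A - inverse A) * (C * C) = (A / (C * C) - inverse (A / (C * C))) + A * d"
      unfolding d_def using nz(1,2) by (simp add: field_simps)
    moreover have "qint (int (Suc n)) * tlim (Suc n) (Suc c)
        = qdel * G / (P * d) * ((A - inverse A) * (C * C))"
      using True by (simp only: tlim_def qint_conv A_def[symmetric] den G2 even_Suc if_True not_not) simp
    moreover have "qint (int n - 2 * int c - 1) * tlim n (Suc c)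
        = qdel * G / (P * d) * (A / (C * C) - inverse (A / (C * C)))"
      using True by (simp only: tlim_def qint_conv A2 den G_def if_False not_not) simp
    moreover have "qdel * qq powi (int n - 2 * int c) * tlim n c = qdel * G / (P * d) * (A * d)"
      using True nz by (simp add: tlim_def A3 G0 P_def)
    ultimately show ?thesis
      using True by (simp only: distrib_left) simp
  next
    case False
    have "A - inverse A = (A / (C * C) - inverse (A / (C * C))) * (C * C)
        + (A * (C * C) / (qq * qq) - (A / qq - inverse (A / qq)) * (C * C) / qq) * d"
      unfolding d_def using nz(1,2) by (simp add: field_simps)
    moreover have "qint (int (Suc n)) * tlim (Suc n) (Suc c) = qdel * G / (P * d) * (A - inverse A)"
      using False by (simp only: tlim_def qint_conv A_def[symmetric] den G_def even_Suc if_False not_not) simp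
    moreover have "qint (int n - 2 * int c - 1) * tlim n (Suc c)
        = qdel * G / (P * d) * ((A / (C * C) - inverse (A / (C * C))) * (C * C))"
      using False by (simp only: tlim_def qint_conv A2 den G2 if_True not_False_eq_True) simp
    moreover have "qdel * qq powi (int n - 2 * int c) * tlim n c
        = qdel * G / (P * d) * (A * (C * C) / (qq * qq) * d)"
      using False nz by (simp add: tlim_def A3 G1 P_def) (simp add: mult_ac)
    moreover have "qint (int n) * tlim (n - 1) c
        = qdel * G / (P * d) * ((A / qq - inverse (A / qq)) * (C * C) / qq * d)"
    proof -
      have "qint (int n) = qdel * (A / qq - inverse (A / qq))"
        by (simp only: qint_conv A1)
      thus ?thesis
        using False nz by (simp add: tlim_def G0 P_def) (simp add: mult_ac)
    qed
    ultimately show ?thesis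
      using False by (simp only: distrib_left left_diff_distrib right_diff_distrib if_True) simp
  qed
qed

definition tlim_coord :: "nat \<Rightarrow> nat \<Rightarrow> qf" where
  "tlim_coord n r = (if r \<le> n \<and> even (n - r) then tlim n ((n - r) div 2) else 0)"

lemma tlim_0 [simp]: "tlim n 0 = 1"
  by (simp add: tlim_def qden_def)

lemma tlim_coord_rec:
  "qint (int (Suc n)) * tlim_coord (Suc n) r
   = qint (int r) * tlim_coord n (r - 1) + qdel * qq powi (int r + 1) * tlim_coord n (r + 1)
     - (if odd n then qint (int n) * tlim_coord (n - 1) r else 0)"
proof -
  \<comment> \<open>Out of range or with the wrong parity all terms vanish, r = n + 1 is the leading
    coordinate 1, and only the last case needs \<open>tlim_rec\<close>.\<close>
  consider "r > Suc n" | "r \<le> Suc n" "odd (Suc n - r)" | "r = Suc n" | c where "Suc n = r + 2 * Suc c"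
  proof -
    have "\<exists>c. Suc n = r + 2 * Suc c" if r: "r \<le> Suc n" "even (Suc n - r)" "r \<noteq> Suc n"
    proof -
      obtain k where k: "Suc n - r = 2 * k"
        using r(2) by (elim evenE)
      obtain c where "k = Suc c"
        using k r by (cases k) auto
      thus ?thesis
        using k r by (intro exI[of _ c]) auto
    qed
    thus ?thesis
      using that by (meson not_le)
  qed
  thus ?thesis
  proof cases
    case 2
    \<comment> \<open>At r = 0 the truncated index r - 1 is again 0, but its coefficient is [0] =
      0.\<close>
    thus ?thesis
      by (cases "r = 0") (auto simp: tlim_coord_def)
  next
    case (4 c)
    have 0: "int r = int n - 2 * int c - 1" "int r + 1 = int n - 2 * int c"
      using 4 by auto
    have 1: "tlim_coord (Suc n) r = tlim (Suc n) (Suc c)"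
      using 4 by (simp add: tlim_coord_def)
    have 2: "qint (int r) * tlim_coord n (r - 1) = qint (int r) * tlim n (Suc c)"
    proof (cases r)
      case (Suc k)
      hence "n = k + 2 * Suc c"
        using 4 by simp
      thus ?thesis
        using Suc by (simp add: tlim_coord_def)
    qed simp
    have 3: "tlim_coord n (r + 1) = tlim n c"
    proof -
      have "n = (r + 1) + 2 * c"
        using 4 by simp
      thus ?thesis
        by (simp add: tlim_coord_def)
    qed
    have "tlim_coord (n - 1) r = tlim (n - 1) c"
    proof -
      have "n - 1 = r + 2 * c"
        using 4 by simp
      thus ?thesis
        by (simp add: tlim_coord_def)
    qed
    thus ?thesis
      unfolding 1 2 3 0(2) unfolding 0(1) using tlim_rec[of n c] by (simp only:)
  qed (auto simp: tlim_coord_def)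
qed

text \<open>The recursion \<open>tdot_Suc\<close> is applied to v, read off at coordinate r and
  passed to the limit. The diagonal term carries q^(2r - mu), which tends to 0, so the limits do not
  depend on m.\<close>

lemma tdot_hw_qlim: "qlim (\<lambda>mu. act (qint m) mu (tdot n) (hw mu) r) (tlim_coord n r)"
proof (induction n arbitrary: r rule: less_induct)
  case (less n)
  show ?case
  proof (cases n)
    case 0
    have "act (qint m) mu (tdot n) (hw mu) r = tlim_coord n r" for mu
      using 0 by (simp add: hw_def tlim_coord_def)
    thus ?thesis
      by (simp add: qlim_const)
  next
    case (Suc k)
    define T where "T j i mu = act (qint m) mu (tdot j) (hw mu) i" for j i mu
    define h where "h = qint (int (Suc k))"
    define odd_part where "odd_part x = (if odd k then qint (int k) * x else 0)" for x
    have lim: "qlim (T k i) (tlim_coord k i)" "qlim (T (k - 1) i) (tlim_coord (k - 1) i)" for i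
      unfolding T_def using less[of k i] less[of "k - 1" i] Suc by auto
    have "qlim (\<lambda>mu. qint (int r) * T k (r - 1) mu
        + (qq powi (2 * int r + 1 - int mu) * qint (int mu - int r)) * T k (r + 1) mu
        + qint m * qq powi (2 * int r - int mu) * T k r mu + - 1 * odd_part (T (k - 1) r mu))
      (qint (int r) * tlim_coord k (r - 1) + qdel * qq powi (int r + 1) * tlim_coord k (r + 1)
        + qint m * 0 * tlim_coord k r + - 1 * odd_part (tlim_coord (k - 1) r))"
    proof -
      have "qlim (\<lambda>mu. odd_part (T (k - 1) r mu)) (odd_part (tlim_coord (k - 1) r))"
        unfolding odd_part_def by (cases "odd k") (auto intro!: qlim_mult qlim_const lim simp del: One_nat_def)
      thus ?thesis
        by (intro qlim_add qlim_mult qlim_const lim qlim_raising qlim_qq_powi_0)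
    qed
    moreover have "qint (int r) * tlim_coord k (r - 1) + qdel * qq powi (int r + 1) * tlim_coord k (r + 1)
        + qint m * 0 * tlim_coord k r + - 1 * odd_part (tlim_coord (k - 1) r) = h * tlim_coord n r"
      unfolding h_def Suc tlim_coord_rec odd_part_def by simp
    moreover have "h * T n r mu = qint (int r) * T k (r - 1) mu
        + (qq powi (2 * int r + 1 - int mu) * qint (int mu - int r)) * T k (r + 1) mu
        + qint m * qq powi (2 * int r - int mu) * T k r mu + - 1 * odd_part (T (k - 1) r mu)"
      if "mu \<ge> r" for mu
    proof -
      have "h * T n r mu = act (qint m) mu (smult h (tdot n)) (hw mu) r"
        by (simp add: T_def act_smult)
      also have "\<dots> = act (qint m) mu ([:0, 1:] * tdot k) (hw mu) r - odd_part (T (k - 1) r mu)"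
        unfolding h_def Suc tdot_Suc act_diff odd_part_def T_def by (simp add: act_smult)
      also have "act (qint m) mu ([:0, 1:] * tdot k) (hw mu) r
          = Defs.top (qint m) mu (act (qint m) mu (tdot k) (hw mu)) r"
        unfolding act_mult by (simp add: act_pCons top_eq)
      finally show ?thesis
        using that by (simp add: top_eq T_def)
    qed
    ultimately have "qlim (\<lambda>mu. h * T n r mu) (h * tlim_coord n r)"
      using qlim_cong by (metis (no_types, lifting))
    hence "qlim (\<lambda>mu. inverse h * (h * T n r mu)) (inverse h * (h * tlim_coord n r))"
      by (rule qlim_mult[OF qlim_const])
    moreover have "inverse h * (h * x) = x" for x
      by (simp add: h_def)
    ultimately show ?thesis
      by (simp only: T_def)
  qed
qed

text \<open>The limit has negative degree, and so has the error once mu > C; as the coordinate is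
  integral for even mu, it lies in \<open>qinvZ\<close>.\<close>

lemma tdot_hw_coord_eventually_qinvZ:
  assumes "odd m" "r < n"
  shows "\<exists>N. \<forall>mu\<ge>N. even mu \<longrightarrow> act (qint m) mu (tdot n) (hw mu) r \<in> qinvZ"
proof -
  have lim: "tlim_coord n r \<in> deg_le (- 1)"
  proof (cases "even (n - r)")
    case True
    hence "(n - r) div 2 > 0"
      using assms(2) by (elim evenE) auto
    thus ?thesis
      by (simp add: tlim_coord_def tlim_deg)
  qed (simp add: tlim_coord_def)
  obtain C where C: "\<And>mu. mu \<ge> C \<Longrightarrow>
      act (qint m) mu (tdot n) (hw mu) r - tlim_coord n r \<in> deg_le (int C - int mu)"
    using tdot_hw_qlim[of m n r] by (auto simp: qlim_def)
  have "act (qint m) mu (tdot n) (hw mu) r \<in> qinvZ" if "mu \<ge> Suc C" "even mu" for mu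
  proof (rule qinvZ_if_deg_le)
    show "act (qint m) mu (tdot n) (hw mu) r \<in> Aset"
      using tspan_act_hw[OF tdot_in_tspan, of m mu n] assms(1) that(2) by (auto simp: LA_def)
    have "act (qint m) mu (tdot n) (hw mu) r - tlim_coord n r \<in> deg_le (- 1)"
      using that(1) by (intro deg_le_mono[OF C]) auto
    from deg_le_add[OF this lim] show "act (qint m) mu (tdot n) (hw mu) r \<in> deg_le (- 1)"
      by simp
  qed
  thus ?thesis
    by blast
qed

lemma tdot_hw_is_icb:
  assumes "odd m"
  shows "\<exists>N. \<forall>lam\<ge>N. is_icb (qint m) (2 * lam) n (act (qint m) (2 * lam) (tdot n) (hw (2 * lam)))"
proof -
  obtain N where N: "\<And>r mu. r < n \<Longrightarrow> mu \<ge> N r \<Longrightarrow> even mu \<Longrightarrow>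
      act (qint m) mu (tdot n) (hw mu) r \<in> qinvZ"
    using tdot_hw_coord_eventually_qinvZ[OF assms, of _ n] by metis
  \<comment> \<open>The sum of all thresholds dominates each \<open>N r\<close>, and the summand n
    ensures that F^(n) v exists in L(2 lam).\<close>
  have "is_icb (qint m) (2 * lam) n (act (qint m) (2 * lam) (tdot n) (hw (2 * lam)))"
    if lam: "lam \<ge> n + (\<Sum>r<n. N r)" for lam
    unfolding is_icb_def
  proof (intro conjI allI impI)
    show "n \<le> 2 * lam"
      using lam by simp
    show "act (qint m) (2 * lam) (tdot n) (hw (2 * lam)) n = 1"
      using lam tdot_coeff[of n] by (subst act_hw_top_coeff(2)[OF degree_tdot_le]) auto
    show "act (qint m) (2 * lam) (tdot n) (hw (2 * lam)) r \<in> qinvZ" if "r < n" for r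
    proof (rule N[OF that])
      have "N r \<le> (\<Sum>r<n. N r)"
        using that by (intro member_le_sum) auto
      thus "N r \<le> 2 * lam"
        using lam by simp
    qed simp
    show "act (qint m) (2 * lam) (tdot n) (hw (2 * lam)) r = 0" if "n < r" for r
      using that by (rule act_hw_top_coeff(1)[OF degree_tdot_le])
  qed (simp_all add: act_inL psiL_act_hw psiU_tdot)
  thus ?thesis
    by blast
qed

theorem theorem4p10:
  fixes l :: int
  defines "kappa \<equiv> qint (2 * l - 1)"
  shows "(\<forall>n. \<exists>N. \<forall>lam::nat\<ge>N. \<exists>a. is_icb kappa (2 * lam) a (act kappa (2 * lam) (tdot n) (hw (2 * lam))))
       \<and> is_icb_family kappa tdot
       \<and> is_A_basis tdot (AUev kappa)"
proof -
  have odd: "odd (2 * l - 1)"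
    by simp
  \<comment> \<open>In the first claim the basis element has index \<open>n\<close>, the same one
    that the family condition demands.\<close>
  show ?thesis
    unfolding kappa_def is_icb_family_def
    using tdot_hw_is_icb[OF odd] tdot_in_AUev[OF odd] tdot_A_basis[OF odd] by meson
qed

end
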